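(* For all $\rho,\beta>0$ the radius of starlikeness $r^{\star}(g_{\rho,\beta})$ satisfies $$\sqrt{\frac{\Gamma(\rho+\beta)}{3\Gamma(\beta)}}<r^\star(g_{\rho,\beta})<\sqrt{\frac{3\Gamma(\rho+\beta)\Gamma(2\rho+\beta)}{\Delta_{9,5}(\rho,\beta)}}$$ and $$\sqrt[4]{\frac{\Gamma^{2}(\rho+\beta)\Gamma(2\rho+\beta)}{\Gamma(\beta)\Delta_{9,5}(\rho,\beta)}}<r^\star(g_{\rho,\beta})<\sqrt{\frac{2\Gamma(\rho+\beta)\Gamma(3\rho+\beta)\Delta_{9,5}(\rho,\beta)}{9\Gamma(\beta)\Gamma(3\rho+\beta)\Delta_{6,5}(\rho,\beta)+7\Gamma^{3}(\rho+\beta)\Gamma(2\rho+\beta)}}.$$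
   Context: The Wright function is the entire function (of $z$) $\phi(\rho,\beta,z)=\sum_{n\ge 0}\frac{z^n}{n!\,\Gamma(n\rho+\beta)}$, and $g_{\rho,\beta}(z)=z\,\Gamma(\beta)\phi(\rho,\beta,-z^2)$. Notation: $\Delta_{a,b}(\rho,\beta)=a\,\Gamma(\beta)\Gamma(2\rho+\beta)-b\,\Gamma^2(\rho+\beta)$, and $\Gamma^k(x)=(\Gamma(x))^k$. For $r>0$ let $\mathbb{D}_r=\{z\in\mathbb{C}:|z|<r\}$. For an analytic $f$ normalized by $f(0)=f'(0)-1=0$, the radius of starlikeness (of order $0$) is $r^{\star}(f)=\sup\{r>0:\ \operatorname{Re}(zf'(z)/f(z))>0\ \text{for all } z\in\mathbb{D}_r\}$ (the quotient has value $1$ at $z=0$). *)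

theory Defs
  imports "HOL-Analysis.Analysis"
begin

text \<open>Since \<^const>\<open>Gamma\<close> is 0 at its poles and division by 0 yields 0, the quotient agrees
  with the usual convention 1/\<Gamma> = 0 there; for positive \<open>\<rho>\<close>, \<open>\<beta>\<close> this does not matter.\<close>

definition wright :: "real \<Rightarrow> real \<Rightarrow> complex \<Rightarrow> complex" where
  "wright \<rho> \<beta> z = (\<Sum>n. z ^ n / (fact n * of_real (Gamma (real n * \<rho> + \<beta>))))"

definition wright_g :: "real \<Rightarrow> real \<Rightarrow> complex \<Rightarrow> complex" where
  "wright_g \<rho> \<beta> z = z * of_real (Gamma \<beta>) * wright \<rho> \<beta> (- (z\<^sup>2))"

definition wright_Delta :: "real \<Rightarrow> real \<Rightarrow> real \<Rightarrow> real \<Rightarrow> real" where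
  "wright_Delta a b \<rho> \<beta> = a * Gamma \<beta> * Gamma (2 * \<rho> + \<beta>) - b * (Gamma (\<rho> + \<beta>))\<^sup>2"

text \<open>The value at 0 is the limit of the quotient for \<open>f\<close> with \<open>f 0 = 0\<close> and \<open>deriv f 0 = 1\<close>.
  At a zero of \<open>f\<close> other than 0 the quotient has a pole and is 0 by the division convention,
  so the positivity condition below fails there, as it should.\<close>

definition starlike_quotient :: "(complex \<Rightarrow> complex) \<Rightarrow> complex \<Rightarrow> complex" where
  "starlike_quotient f z = (if z = 0 then 1 else z * deriv f z / f z)"

text \<open>Intended for entire \<open>f\<close> with \<open>f 0 = 0\<close> and \<open>deriv f 0 = 1\<close>. The supremum is taken in
  \<^typ>\<open>ereal\<close>, so that it is meaningful even where the set of radii is unbounded.\<close>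

definition starlikeness_radius :: "(complex \<Rightarrow> complex) \<Rightarrow> ereal" where
  "starlikeness_radius f =
     (SUP r \<in> {r::real. r > 0 \<and> (\<forall>z\<in>ball 0 r. Re (starlike_quotient f z) > 0)}. ereal r)"

end

theory Submission
  imports Defs "HOL-Computational_Algebra.Fundamental_Theorem_Algebra"
begin

text \<open>Write \<open>g z = z * f (z\<^sup>2)\<close>. Then \<open>z g'(z) / g(z) = \<psi> (z\<^sup>2) / f (z\<^sup>2)\<close> with
  \<open>\<psi> = (1 + 2 \<theta>) f\<close>, \<open>\<theta> = x d/dx\<close>. By the product formula for the Gamma function, \<open>f\<close> is the limit of the
  polynomials obtained from \<open>(1 - c x)\<^sup>n\<close> by applying the operators \<open>1 + \<rho> / (\<beta> + j) \<theta>\<close>, and these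
  operators preserve the class of products of factors \<open>1 - y x\<close> with \<open>y > 0\<close>. Hence the squared radius
  is the first zero of \<open>\<psi>\<close>, and for the approximants Euler's method locates it between
  \<open>S\<^sub>k\<^bsup>-1/k\<^esup>\<close> and \<open>S\<^sub>k / S\<^sub>k\<^sub>+\<^sub>1\<close>, where \<open>S\<^sub>k\<close> is the sum of the \<open>y\<^sup>k\<close>, a polynomial in the
  coefficients. The inequalities stay strict in the limit because the bounds for larger \<open>k\<close> are
  sharper: a limit of equality would turn \<open>\<psi>\<close> into a linear factor times an exponential, which the decay
  of its coefficients excludes.\<close>

subsection \<open>Polynomials with positive roots\<close>

text \<open>The \<open>y i\<close> are the reciprocals of the zeros, listed with multiplicity. The
  form also fixes the value 1 at 0 and admits the empty product.\<close>

definition positive_rooted :: "real poly \<Rightarrow> bool" where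
  "positive_rooted p \<longleftrightarrow>
     (\<exists>(n::nat) y. (\<forall>i<n. 0 < y i) \<and> p = (\<Prod>i<n. [:1, - y i:]))"

lemma positive_rootedE:
  assumes "positive_rooted p"
  obtains n :: nat and y :: "nat \<Rightarrow> real" where "\<And>i. i < n \<Longrightarrow> 0 < y i" "p = (\<Prod>i<n. [:1, - y i:])"
proof -
  from assms obtain n :: nat and y :: "nat \<Rightarrow> real" where "\<forall>i<n. 0 < y i" "p = (\<Prod>i<n. [:1, - y i:])"
    unfolding positive_rooted_def by (elim exE conjE)
  then show thesis by (intro that[of n y]) auto
qed

text \<open>This is 1 + \<kappa> \<theta>, diagonal on monomials. The choice \<kappa> = 2 leads to
  the numerator of the starlike quotient, the choices \<rho> / (\<beta> + j) to quotients of Gamma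
  values. Both real and complex coefficients occur.\<close>

definition euler_op :: "'a::idom \<Rightarrow> 'a poly \<Rightarrow> 'a poly" where
  "euler_op \<kappa> p = p + smult \<kappa> (pCons 0 (pderiv p))"

lemma coeff_euler_op:
  fixes p :: "'a::idom poly"
  shows "coeff (euler_op \<kappa> p) k = (1 + \<kappa> * of_nat k) * coeff p k"
  by (cases k) (simp_all add: euler_op_def coeff_pderiv algebra_simps)

lemma poly_euler_op: "poly (euler_op \<kappa> p) z = poly p z + \<kappa> * (z * poly (pderiv p) z)"
  by (simp add: euler_op_def)

abbreviation cpoly :: "real poly \<Rightarrow> complex poly" where
  "cpoly \<equiv> map_poly complex_of_real"

lemma cpoly_euler_op: "cpoly (euler_op \<kappa> p) = euler_op (of_real \<kappa>) (cpoly p)"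
  by (rule poly_eqI) (simp add: coeff_euler_op coeff_map_poly)

lemma cpoly_mult: "cpoly (p * q) = cpoly p * cpoly q"
  by (rule poly_eqI) (simp add: coeff_mult coeff_map_poly)

lemma cpoly_prod: "cpoly (\<Prod>i\<in>A. f i) = (\<Prod>i\<in>A. cpoly (f i))"
  by (induction A rule: infinite_finite_induct) (simp_all add: cpoly_mult map_poly_1)

lemma cpoly_inject: "cpoly p = cpoly q \<longleftrightarrow> p = q"
  by (simp add: poly_eq_iff coeff_map_poly)

lemma cpoly_linear_prod:
  "cpoly (\<Prod>i<n::nat. [:1, - y i:]) = (\<Prod>i<n. [:1, - of_real (y i):])"
  by (simp add: cpoly_prod map_poly_pCons)

text \<open>The logarithmic derivative of the product, cleared of its denominator; it serves at real
  as well as complex points.\<close>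

lemma poly_pderiv_linear_prod:
  fixes y :: "nat \<Rightarrow> 'a::field"
  assumes "\<And>i. i < n \<Longrightarrow> 1 - y i * z \<noteq> 0"
  shows "z * poly (pderiv (\<Prod>i<n. [:1, - y i:])) z =
         - poly (\<Prod>i<n. [:1, - y i:]) z * (\<Sum>i<n. y i * z / (1 - y i * z))"
  using assms
proof (induction n)
  case (Suc n)
  let ?P = "\<Prod>i<n. [:1, - y i:]"
  have IH: "z * poly (pderiv ?P) z = - poly ?P z * (\<Sum>i<n. y i * z / (1 - y i * z))"
    using Suc by simp
  have nz: "1 - y n * z \<noteq> 0" using Suc.prems by simp
  have "z * poly (pderiv (\<Prod>i<Suc n. [:1, - y i:])) z =
      (1 - y n * z) * (z * poly (pderiv ?P) z) - y n * z * poly ?P z"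
    unfolding prod.lessThan_Suc pderiv_mult by (simp add: pderiv_pCons algebra_simps del: mult_pCons_right)
  also have "\<dots> = - ((1 - y n * z) * poly ?P z) *
      ((\<Sum>i<n. y i * z / (1 - y i * z)) + y n * z / (1 - y n * z))"
    unfolding IH using nz by (simp add: field_simps)
  also have "\<dots> = - poly (\<Prod>i<Suc n. [:1, - y i:]) z *
      (\<Sum>i<Suc n. y i * z / (1 - y i * z))"
    by (simp add: algebra_simps)
  finally show ?case .
qed simp

lemma poly_euler_op_linear_prod:
  fixes y :: "nat \<Rightarrow> 'a::field"
  assumes "\<And>i. i < n \<Longrightarrow> 1 - y i * z \<noteq> 0"
  shows "poly (euler_op \<kappa> (\<Prod>i<n. [:1, - y i:])) z =
         poly (\<Prod>i<n. [:1, - y i:]) z * (1 - \<kappa> * (\<Sum>i<n. y i * z / (1 - y i * z)))"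
  by (simp add: poly_euler_op poly_pderiv_linear_prod[OF assms] algebra_simps)

text \<open>Over the complex numbers \<open>p\<close> splits. Pulling \<open>- r i\<close> out of
  each linear factor leaves factors of the required shape, and the accumulated constant is the value
  at 0, which is 1.\<close>

lemma positive_rootedI:
  assumes "coeff p 0 = 1"
    and roots: "\<And>z. poly (cpoly p) z = 0 \<Longrightarrow> \<exists>x>0. z = of_real x"
  shows "positive_rooted p"
proof -
  let ?P = "cpoly p"
  have c0: "coeff ?P 0 = 1" using assms(1) by (simp add: coeff_map_poly)
  define n where "n = degree ?P"
  define a where "a = lead_coeff ?P"
  obtain r where P: "?P = smult a (\<Prod>i<n. [:- r i, 1:])"
    using complex_poly_decompose'[of ?P] unfolding n_def a_def by metis
  have "\<exists>x>0. r i = of_real x" if "i < n" for i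
  proof (rule roots)
    show "poly ?P (r i) = 0" unfolding P using that by (auto simp: poly_prod)
  qed
  then obtain x where x: "\<And>i. i < n \<Longrightarrow> 0 < x i \<and> r i = of_real (x i)" by metis
  have 1: "1 = a * (\<Prod>i<n. - (of_real (x i)))"
  proof -
    have "1 = poly ?P 0" using c0 by (simp add: poly_0_coeff_0)
    also have "\<dots> = a * (\<Prod>i<n. - (r i))" unfolding P by (simp add: poly_prod)
    also have "\<dots> = a * (\<Prod>i<n. - (of_real (x i)))" using x by (intro arg_cong[of _ _ "(*) a"] prod.cong) auto
    finally show ?thesis .
  qed
  have "?P = smult a (\<Prod>i<n. smult (- of_real (x i)) [:1, - of_real (inverse (x i)):])"
    unfolding P
  proof (intro arg_cong[of _ _ "smult a"] prod.cong refl)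
    fix i assume "i \<in> {..<n}"
    then have "0 < x i" "r i = of_real (x i)" using x by auto
    then show "[:- r i, 1:] = smult (- of_real (x i)) [:1, - of_real (inverse (x i)):]" by simp
  qed
  also have "\<dots> = smult (a * (\<Prod>i<n. - (of_real (x i)))) (\<Prod>i<n. [:1, - of_real (inverse (x i)):])"
    by (simp only: prod_smult smult_smult)
  also have "\<dots> = cpoly (\<Prod>i<n. [:1, - inverse (x i):])"
    unfolding 1[symmetric] cpoly_linear_prod by simp
  finally have "p = (\<Prod>i<n. [:1, - inverse (x i):])" by (simp only: cpoly_inject)
  then show ?thesis unfolding positive_rooted_def using x
    by (intro exI[of _ n] exI[of _ "\<lambda>i. inverse (x i)"]) auto
qed

lemma coeff_0_linear_prod: "coeff (\<Prod>i<n::nat. [:1, - y i:]) 0 = (1::'a::comm_ring_1)"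
  by (induction n) (simp_all add: coeff_mult)

lemma positive_rooted_coeff_0: "positive_rooted p \<Longrightarrow> coeff p 0 = 1"
  by (auto simp: positive_rooted_def coeff_0_linear_prod)

text \<open>At a non-real zero \<open>z\<close> of the image, all terms of the logarithmic derivative have imaginary
  parts of the same sign, which is impossible.\<close>

lemma positive_rooted_euler_op:
  assumes "positive_rooted p" and \<kappa>: "0 < \<kappa>"
  shows "positive_rooted (euler_op \<kappa> p)"
proof (rule positive_rootedI)
  show "coeff (euler_op \<kappa> p) 0 = 1"
    using positive_rooted_coeff_0[OF assms(1)] by (simp add: coeff_euler_op)
  obtain n :: nat and y :: "nat \<Rightarrow> real" where y: "\<And>i. i < n \<Longrightarrow> 0 < y i" and p: "p = (\<Prod>i<n. [:1, - y i:])"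
    by (rule positive_rootedE[OF assms(1)]) (rule that)
  fix z assume z: "poly (cpoly (euler_op \<kappa> p)) z = 0"
  show "\<exists>x>0. z = of_real x"
  proof (cases "\<exists>i<n. 1 - of_real (y i) * z = 0")
    \<comment> \<open>A zero shared with \<open>p\<close> is some 1 / \<open>y i\<close>.\<close>
    case True
    then obtain i where i: "i < n" "of_real (y i) * z = 1" by auto
    then have "z = of_real (inverse (y i))" using y[of i] by (simp add: field_simps)
    then show ?thesis using y[OF i(1)] by (intro exI[of _ "inverse (y i)"]) simp
  next
    case False
    have "poly (cpoly p) z \<noteq> 0"
      using False by (auto simp: p cpoly_linear_prod poly_prod mult.commute)
    moreover have "poly (cpoly p) z * (1 - of_real \<kappa> * (\<Sum>i<n. of_real (y i) * z / (1 - of_real (y i) * z))) = 0"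
      using z False poly_euler_op_linear_prod[of n "\<lambda>i. complex_of_real (y i)" z "of_real \<kappa>"]
      by (simp add: cpoly_euler_op p cpoly_linear_prod)
    ultimately have eq: "of_real \<kappa> * (\<Sum>i<n. of_real (y i) * z / (1 - of_real (y i) * z)) = 1"
      by simp
    have im: "Im (of_real (y i) * z / (1 - of_real (y i) * z)) =
        Im z * (y i / (cmod (1 - of_real (y i) * z))\<^sup>2)" for i
      unfolding cmod_power2 by (simp add: Im_divide algebra_simps)
    have "\<kappa> * (Im z * (\<Sum>i<n. y i / (cmod (1 - of_real (y i) * z))\<^sup>2)) = 0"
    proof -
      have "Im (of_real \<kappa> * (\<Sum>i<n. of_real (y i) * z / (1 - of_real (y i) * z))) =
          \<kappa> * (Im z * (\<Sum>i<n. y i / (cmod (1 - of_real (y i) * z))\<^sup>2))"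
        by (simp only: Im_complex_of_real Im_sum im sum_distrib_left times_complex.sel
            Re_complex_of_real mult_zero_left add_0_right)
      then show ?thesis by (simp only: eq one_complex.sel)
    qed
    \<comment> \<open>Without factors the sum in \<open>eq\<close> would be 0.\<close>
    moreover have "n > 0" using eq by (cases n) auto
    then have "0 < (\<Sum>i<n. y i / (cmod (1 - of_real (y i) * z))\<^sup>2)"
      using False y by (intro sum_pos divide_pos_pos) auto
    ultimately have "Im z = 0" using \<kappa> by simp
    then have zr: "z = of_real (Re z)" by (simp add: complex_eq_iff)
    have "\<kappa> * (\<Sum>i<n. y i * Re z / (1 - y i * Re z)) = 1"
    proof -
      have "complex_of_real (\<kappa> * (\<Sum>i<n. y i * Re z / (1 - y i * Re z))) = of_real 1"
        using eq by (subst (asm) (1 2) zr) simp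
      then show ?thesis by (simp only: of_real_eq_iff)
    qed
    \<comment> \<open>A nonpositive real zero would make every summand nonpositive, although the sum
      equals 1 / \<kappa>.\<close>
    moreover have "(\<Sum>i<n. y i * Re z / (1 - y i * Re z)) \<le> 0" if "Re z \<le> 0"
    proof (intro sum_nonpos divide_nonpos_pos)
      fix i assume "i \<in> {..<n}"
      then have "0 < y i" using y by auto
      then show "y i * Re z \<le> 0" using that by (simp add: mult_nonneg_nonpos)
      then show "0 < 1 - y i * Re z" by simp
    qed
    ultimately have "0 < Re z" using \<kappa> by (smt (verit) mult_nonneg_nonpos)
    then show ?thesis using zr by blast
  qed
qed

subsection \<open>Power sums of the reciprocal roots\<close>

text \<open>For a product of factors 1 - \<open>y i\<close> x this is the k-th elementary symmetric
  function of the \<open>y i\<close>.\<close>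

definition alt_coeff :: "real poly \<Rightarrow> nat \<Rightarrow> real" where
  "alt_coeff p k = (-1) ^ k * coeff p k"

text \<open>Newton's identities for the power sums of order 2, 3 and 4. They take an arbitrary
  sequence, so they also apply to limits of coefficients, where no finite family \<open>y\<close> is
  at hand.\<close>

definition power_sum2 :: "(nat \<Rightarrow> real) \<Rightarrow> real" where
  "power_sum2 e = (e 1)\<^sup>2 - 2 * e 2"

definition power_sum3 :: "(nat \<Rightarrow> real) \<Rightarrow> real" where
  "power_sum3 e = (e 1) ^ 3 - 3 * e 1 * e 2 + 3 * e 3"

definition power_sum4 :: "(nat \<Rightarrow> real) \<Rightarrow> real" where
  "power_sum4 e = (e 1) ^ 4 - 4 * (e 1)\<^sup>2 * e 2 + 2 * (e 2)\<^sup>2 + 4 * e 1 * e 3 - 4 * e 4"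

lemma alt_coeff_mult_linear_0: "alt_coeff ([:1, - y:] * p) 0 = alt_coeff p 0"
  by (simp add: alt_coeff_def coeff_mult)

lemma alt_coeff_mult_linear_Suc:
  "alt_coeff ([:1, - y:] * p) (Suc k) = alt_coeff p (Suc k) + y * alt_coeff p k"
  by (simp add: alt_coeff_def algebra_simps)

lemma alt_coeff_linear_prod_nonneg:
  assumes "\<And>i. i \<in> A \<Longrightarrow> 0 \<le> y i"
  shows "0 \<le> alt_coeff (\<Prod>i\<in>A. [:1, - y i:]) k"
  using assms
proof (induction A arbitrary: k rule: infinite_finite_induct)
  case (insert a A)
  then show ?case
    by (cases k) (auto simp: alt_coeff_mult_linear_0 alt_coeff_mult_linear_Suc
        simp del: mult_pCons_left)
qed (auto simp: alt_coeff_def coeff_1)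

text \<open>Restoring a factor adds a nonnegative multiple of the preceding coefficient. This
  controls the cofactors in \<open>recursion_defect\<close>.\<close>

lemma alt_coeff_linear_prod_remove_le:
  assumes "finite A" "i \<in> A" "\<And>i. i \<in> A \<Longrightarrow> 0 \<le> y i"
  shows "alt_coeff (\<Prod>j\<in>A-{i}. [:1, - y j:]) k \<le> alt_coeff (\<Prod>j\<in>A. [:1, - y j:]) k"
  unfolding prod.remove[OF assms(1,2)]
  using assms alt_coeff_linear_prod_nonneg[of "A - {i}" y]
  by (cases k) (auto simp: alt_coeff_mult_linear_0 alt_coeff_mult_linear_Suc
      simp del: mult_pCons_left)

lemma power_sums_linear_prod:
  fixes y :: "nat \<Rightarrow> real"
  defines "e \<equiv> \<lambda>n. alt_coeff (\<Prod>i<n. [:1, - y i:])"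
  shows "(\<Sum>i<n. y i) = e n 1" and "(\<Sum>i<n. (y i)\<^sup>2) = power_sum2 (e n)"
    and "(\<Sum>i<n. y i ^ 3) = power_sum3 (e n)" and "(\<Sum>i<n. y i ^ 4) = power_sum4 (e n)"
proof -
  have e0: "e n 0 = 1" for n by (simp add: e_def alt_coeff_def coeff_0_linear_prod)
  have "e (Suc n) (Suc k) = e n (Suc k) + y n * e n k" for n k
    unfolding e_def prod.lessThan_Suc mult.commute[of _ "[:1, - y n:]"]
    by (rule alt_coeff_mult_linear_Suc)
  from this[of _ 0] this[of _ 1] this[of _ 2] this[of _ 3] e0
  have e: "e (Suc n) 1 = e n 1 + y n" "e (Suc n) 2 = e n 2 + y n * e n 1"
    "e (Suc n) 3 = e n 3 + y n * e n 2" "e (Suc n) 4 = e n 4 + y n * e n 3" for n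
    by (simp_all add: numeral_2_eq_2 numeral_3_eq_3 eval_nat_numeral)
  note e' = e e(1)[unfolded One_nat_def]
  have z: "e 0 k = 0" if "k > 0" for k using that by (cases k) (auto simp: e_def alt_coeff_def)
  show "(\<Sum>i<n. y i) = e n 1" by (induction n) (simp_all add: z e')
  show "(\<Sum>i<n. (y i)\<^sup>2) = power_sum2 (e n)"
    by (induction n) (simp_all add: z e' power_sum2_def power2_eq_square algebra_simps)
  show "(\<Sum>i<n. y i ^ 3) = power_sum3 (e n)"
    by (induction n) (simp_all add: z e' power_sum3_def power2_eq_square power3_eq_cube algebra_simps)
  show "(\<Sum>i<n. y i ^ 4) = power_sum4 (e n)"
    by (induction n) (simp_all add: z e' power_sum4_def power2_eq_square power4_eq_xxxx algebra_simps)
qed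

section \<open>Estimates for a single finite product of linear factors\<close>

locale linear_factors =
  fixes n :: nat and y :: "nat \<Rightarrow> real" and p :: "real poly"
  assumes y: "\<And>i. i < n \<Longrightarrow> 0 < y i" and p: "p = (\<Prod>i<n. [:1, - y i:])"
begin

abbreviation "e \<equiv> alt_coeff p"

lemmas power_sums = power_sums_linear_prod[of y n, folded p]

lemma poly_eq: "poly p x = (\<Prod>i<n. 1 - y i * x)"
  by (simp add: p poly_prod mult.commute)

lemma e_nonneg: "0 \<le> e k"
  unfolding p using y by (intro alt_coeff_linear_prod_nonneg) (auto intro: less_imp_le)

lemma power_sums_nonneg: "0 \<le> power_sum2 e" "0 \<le> power_sum3 e" "0 \<le> power_sum4 e"
  using y unfolding power_sums[symmetric] by (auto intro!: sum_nonneg simp: less_imp_le)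

lemma power_sum2_le: "power_sum2 e \<le> (e 1)\<^sup>2"
  using e_nonneg[of 2] by (simp add: power_sum2_def)

text \<open>Cauchy-Schwarz for the families y^(1/2) and y^(3/2).\<close>

lemma power_sum2_square_le: "(power_sum2 e)\<^sup>2 \<le> e 1 * power_sum3 e"
proof -
  have "(\<Sum>i<n. sqrt (y i) * (y i * sqrt (y i)))\<^sup>2 \<le> 
      (\<Sum>i<n. (sqrt (y i))\<^sup>2) * (\<Sum>i<n. (y i * sqrt (y i))\<^sup>2)"
    by (rule Cauchy_Schwarz_ineq_sum)
  moreover have "(\<Sum>i<n. sqrt (y i) * (y i * sqrt (y i))) = (\<Sum>i<n. (y i)\<^sup>2)"
    using y by (intro sum.cong) (auto simp: power2_eq_square less_imp_le)
  moreover have "(\<Sum>i<n. (sqrt (y i))\<^sup>2) = (\<Sum>i<n. y i)"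
    using y by (intro sum.cong) (auto simp: less_imp_le)
  moreover have "(\<Sum>i<n. (y i * sqrt (y i))\<^sup>2) = (\<Sum>i<n. y i ^ 3)"
    using y by (intro sum.cong) (auto simp: power_mult_distrib less_imp_le power3_eq_cube power2_eq_square)
  ultimately show ?thesis by (simp add: power_sums)
qed

text \<open>Each \<open>y i\<close> is at most the square root of the second power sum, because its
  square is one of the summands. Squaring removes the root and leaves a polynomial inequality, which
  passes to limits.\<close>

lemma power_sum4_square_le: "(power_sum4 e)\<^sup>2 \<le> power_sum2 e * (power_sum3 e)\<^sup>2"
proof -
  have "y i \<le> sqrt (power_sum2 e)" if "i < n" for i
  proof (rule real_le_rsqrt)
    show "(y i)\<^sup>2 \<le> power_sum2 e"
      unfolding power_sums[symmetric] using that by (intro member_le_sum) auto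
  qed
  then have "(\<Sum>i<n. y i * y i ^ 3) \<le> (\<Sum>i<n. sqrt (power_sum2 e) * y i ^ 3)"
    using y by (intro sum_mono mult_right_mono) (auto simp: less_imp_le)
  also have "(\<Sum>i<n. y i * y i ^ 3) = power_sum4 e"
    by (simp add: power_sums[symmetric] eval_nat_numeral)
  also have "(\<Sum>i<n. sqrt (power_sum2 e) * y i ^ 3) = sqrt (power_sum2 e) * power_sum3 e"
    by (simp add: power_sums(3) flip: sum_distrib_left)
  finally have "(power_sum4 e)\<^sup>2 \<le> (sqrt (power_sum2 e) * power_sum3 e)\<^sup>2"
    using power_sums_nonneg by (intro power_mono)
  then show ?thesis using power_sums_nonneg by (simp add: power_mult_distrib)
qed

text \<open>If \<open>power_sum4 e - 2 * c * power_sum3 e + c\<^sup>2 * power_sum2 e\<close> vanishes, then \<open>y i = c\<close> for all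
  \<open>i\<close>. In the limit of infinitely many factors this degenerates to a linear factor times an
  exponential, a solution of a first order differential equation. The left-hand side below is the
  defect of the corresponding recursion for the coefficients.\<close>

lemma recursion_defect:
  "(real (k + 3) * e (k + 3) + c * real (k + 2) * e (k + 2) - e 1 * e (k + 2)
     - (c * e 1 - power_sum2 e) * e (k + 1))\<^sup>2
   \<le> (power_sum4 e - 2 * c * power_sum3 e + c\<^sup>2 * power_sum2 e) * (power_sum2 e * (e k)\<^sup>2)"
proof -
  define P where "P i = (\<Prod>j\<in>{..<n}-{i}. [:1, - y j:])" for i
  have rem: "p = [:1, - y i:] * P i" if "i < n" for i
    unfolding p P_def using that by (subst prod.remove[of _ i]) auto
  \<comment> \<open>Since - p' / p is the sum of y / (1 - y x), the linear polynomial on the left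
    consists of the first two Taylor terms of - (1 - c x) p' / p. What remains starts at x^2, and
    each summand carries a factor y - c.\<close>
  have "[:1, - c:] * pderiv p + [:e 1, power_sum2 e - c * e 1:] * p =
      (\<Sum>i<n. monom (- ((y i)\<^sup>2 * (y i - c))) 2 * P i)"
  proof -
    have 1: "pderiv p = (\<Sum>i<n. P i * [:- y i:])"
      by (simp add: p P_def pderiv_prod pderiv_pCons del: mult_pCons_right)
    have psum: "[:e 1, power_sum2 e - c * e 1:] = (\<Sum>i<n. [:y i, (y i)\<^sup>2 - c * y i:])"
      by (rule poly_eqI) (auto simp: coeff_sum coeff_pCons sum_subtractf power_sums
          simp flip: sum_distrib_left split: nat.splits)
    have 2: "[:e 1, power_sum2 e - c * e 1:] * p =
        (\<Sum>i<n. [:y i, (y i)\<^sup>2 - c * y i:] * ([:1, - y i:] * P i))"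
      unfolding psum sum_distrib_right by (intro sum.cong refl, subst rem[symmetric]) auto
    have 3: "[:1, - c:] * (P i * [:- y i:]) + [:y i, (y i)\<^sup>2 - c * y i:] * ([:1, - y i:] * P i)
        = monom (- ((y i)\<^sup>2 * (y i - c))) 2 * P i" for i
    proof -
      have "[:1, - c:] * [:- y i:] + [:y i, (y i)\<^sup>2 - c * y i:] * [:1, - y i:]
          = monom (- ((y i)\<^sup>2 * (y i - c))) 2"
        by (simp add: monom_altdef numeral_2_eq_2 algebra_simps)
      from this[symmetric] show ?thesis
        by (simp only: distrib_right mult.assoc mult.commute[of "P i"])
    qed
    show ?thesis unfolding 1 2 sum_distrib_left sum.distrib[symmetric] 3 ..
  qed
  then have "coeff ([:1, - c:] * pderiv p + [:e 1, power_sum2 e - c * e 1:] * p) (k + 2) =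
      coeff (\<Sum>i<n. monom (- ((y i)\<^sup>2 * (y i - c))) 2 * P i) (k + 2)"
    by simp
  then have "real (k + 3) * coeff p (k + 3) - c * (real (k + 2) * coeff p (k + 2))
      + e 1 * coeff p (k + 2) + (power_sum2 e - c * e 1) * coeff p (k + 1) =
      - (\<Sum>i<n. (y i)\<^sup>2 * (y i - c) * coeff (P i) k)"
    by (simp add: coeff_sum coeff_monom_mult coeff_pderiv sum_negf eval_nat_numeral)
  moreover have cp: "coeff p j = (-1) ^ j * e j" for j
    by (simp add: alt_coeff_def flip: mult.assoc power_mult_distrib)
  ultimately have "(-1) ^ k * (real (k + 3) * e (k + 3) + c * real (k + 2) * e (k + 2) - e 1 * e (k + 2)
     - (c * e 1 - power_sum2 e) * e (k + 1)) =
      (\<Sum>i<n. (y i)\<^sup>2 * (y i - c) * coeff (P i) k)"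
    unfolding cp by (simp add: power_add algebra_simps)
  from arg_cong[OF this, of "\<lambda>x. (-1) ^ k * x"]
  have "real (k + 3) * e (k + 3) + c * real (k + 2) * e (k + 2) - e 1 * e (k + 2)
     - (c * e 1 - power_sum2 e) * e (k + 1) =
      (-1) ^ k * (\<Sum>i<n. (y i)\<^sup>2 * (y i - c) * coeff (P i) k)"
    by (simp flip: mult.assoc power_mult_distrib)
  \<comment> \<open>One factor \<open>y i\<close> goes to each side before Cauchy-Schwarz: the first
    sum of squares is then the variance expression, the second is bounded by the second power
    sum.\<close>
  also have "\<dots> = (\<Sum>i<n. (y i * (y i - c)) * (y i * alt_coeff (P i) k))"
    unfolding sum_distrib_left
    by (intro sum.cong) (simp_all add: alt_coeff_def power2_eq_square algebra_simps)
  finally have "(real (k + 3) * e (k + 3) + c * real (k + 2) * e (k + 2) - e 1 * e (k + 2)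
     - (c * e 1 - power_sum2 e) * e (k + 1))\<^sup>2 =
      (\<Sum>i<n. (y i * (y i - c)) * (y i * alt_coeff (P i) k))\<^sup>2"
    by simp
  also have "\<dots> \<le> (\<Sum>i<n. (y i * (y i - c))\<^sup>2) * (\<Sum>i<n. (y i * alt_coeff (P i) k)\<^sup>2)"
    by (rule Cauchy_Schwarz_ineq_sum)
  also have "\<dots> \<le> (\<Sum>i<n. (y i * (y i - c))\<^sup>2) * (\<Sum>i<n. (y i)\<^sup>2 * (e k)\<^sup>2)"
  proof (intro mult_left_mono sum_mono sum_nonneg)
    fix i assume i: "i \<in> {..<n}"
    have "0 \<le> alt_coeff (P i) k" "alt_coeff (P i) k \<le> e k"
      using i y less_imp_le unfolding P_def p
      by (auto intro!: alt_coeff_linear_prod_nonneg alt_coeff_linear_prod_remove_le)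
    then show "(y i * alt_coeff (P i) k)\<^sup>2 \<le> (y i)\<^sup>2 * (e k)\<^sup>2"
      by (simp add: power_mult_distrib mult_left_mono power_mono)
  qed auto
  also have "(\<Sum>i<n. (y i * (y i - c))\<^sup>2) =
      power_sum4 e - 2 * c * power_sum3 e + c\<^sup>2 * power_sum2 e"
    unfolding power_sums[symmetric] sum_distrib_left sum_subtractf[symmetric] sum.distrib[symmetric]
    by (intro sum.cong) (auto simp: algebra_simps eval_nat_numeral)
  also have "(\<Sum>i<n. (y i)\<^sup>2 * (e k)\<^sup>2) = power_sum2 e * (e k)\<^sup>2"
    by (simp add: power_sums flip: sum_distrib_right)
  finally show ?thesis .
qed

text \<open>The bound depends on the factors only through their sum and fourth power sum, so it is
  stable under limits with growing \<open>n\<close>. For 0 \<le> u \<le> y t \<le> s < 1 one has 1 /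
  (1 - u) = 1 + u / (1 - u) \<le> exp (y t / (1 - s)).\<close>

lemma poly_ge_exp:
  assumes t: "power_sum4 e * t ^ 4 \<le> s ^ 4" and s: "0 \<le> s" "s < 1" and x: "0 \<le> x" "x \<le> t"
  shows "exp (- (e 1 * t / (1 - s))) \<le> poly p x"
proof -
  have le: "exp (- (y i * t / (1 - s))) \<le> 1 - y i * x" if i: "i < n" for i
  proof -
    have "y i ^ 4 \<le> power_sum4 e"
      unfolding power_sums[symmetric] using i by (intro member_le_sum) auto
    then have "(y i * t) ^ 4 \<le> s ^ 4"
      using t mult_right_mono[of "y i ^ 4" "power_sum4 e" "t ^ 4"] by (simp add: power_mult_distrib)
    \<comment> \<open>\<open>power_le_imp_le_base\<close> speaks of the exponent
      \<open>Suc n\<close>, so 3 stands for the fourth power.\<close>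
    then have ts: "y i * t \<le> s"
      using s by (rule_tac power_le_imp_le_base[of _ 3]) (auto simp: eval_nat_numeral)
    have u: "0 \<le> y i * x" "y i * x \<le> y i * t" using y[OF i] x by (auto simp: mult_left_mono)
    have "1 / (1 - y i * x) = 1 + y i * x / (1 - y i * x)"
      using u ts s by (simp add: field_simps)
    also have "y i * x / (1 - y i * x) \<le> y i * t / (1 - s)"
      using u ts s by (intro frac_le) auto
    also have "1 + y i * t / (1 - s) \<le> exp (y i * t / (1 - s))" by (rule exp_ge_add_one_self)
    finally show ?thesis using u ts s by (simp add: exp_minus field_simps)
  qed
  have "exp (- (e 1 * t / (1 - s))) = (\<Prod>i<n. exp (- (y i * t / (1 - s))))"
    by (simp add: power_sums(1)[symmetric] sum_distrib_right sum_divide_distrib sum_negf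
        del: One_nat_def flip: exp_sum)
  also have "\<dots> \<le> poly p x"
    unfolding poly_eq using le by (intro prod_mono) auto
  finally show ?thesis .
qed

text \<open>The quotient of the fourth by the third power sum is a mean of the \<open>y i\<close>
  with weights y^3, so some \<open>y i\<close> is at least as large.\<close>

lemma ex_root_le:
  assumes "0 < power_sum3 e"
  shows "\<exists>x>0. x * power_sum4 e \<le> power_sum3 e \<and> poly p x = 0"
proof -
  have "\<exists>i<n. power_sum4 e \<le> y i * power_sum3 e"
  proof (rule ccontr)
    assume "\<not> ?thesis"
    then have l: "y i < power_sum4 e / power_sum3 e" if "i < n" for i
      using that assms by (auto simp: field_simps not_le)
    have "n \<noteq> 0" using assms unfolding power_sums[symmetric] by (cases n) auto
    then have "(\<Sum>i<n. y i * y i ^ 3) < (\<Sum>i<n. power_sum4 e / power_sum3 e * y i ^ 3)"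
      using l y by (intro sum_strict_mono mult_strict_right_mono) auto
    also have "\<dots> = power_sum4 e"
      using assms unfolding sum_distrib_left[symmetric] power_sums(3) by simp
    also have "\<dots> = (\<Sum>i<n. y i * y i ^ 3)"
      by (simp add: power_sums[symmetric] eval_nat_numeral)
    finally show False by simp
  qed
  then obtain i where i: "i < n" "power_sum4 e \<le> y i * power_sum3 e" by blast
  have "poly p (1 / y i) = 0"
    unfolding poly_eq using i(1) y[OF i(1)] by auto
  then show ?thesis using i y[OF i(1)] by (intro exI[of _ "1 / y i"]) (auto simp: field_simps)
qed

text \<open>Were the first root \<open>1 / y i\<close> of \<open>p\<close> at most \<open>R\<close>, \<open>euler_op \<kappa> p\<close> would take the value
  \<open>\<kappa> / y i * poly (pderiv p) (1 / y i) \<le> 0\<close> there.\<close>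

lemma factor_less_1:
  assumes "0 < \<kappa>" and pos: "\<And>x. 0 \<le> x \<Longrightarrow> x \<le> R \<Longrightarrow> 0 < poly (euler_op \<kappa> p) x"
    and i: "i < n"
  shows "y i * R < 1"
proof (rule ccontr)
  assume "\<not> ?thesis"
  then have 1: "1 \<le> y i * R" by simp
  \<comment> \<open>The largest \<open>y m\<close> belongs to the smallest zero, where all other
    factors are still nonnegative.\<close>
  have "\<exists>m<n. \<forall>j<n. y j \<le> y m"
  proof -
    have "Max (y ` {..<n}) \<in> y ` {..<n}" using i by (intro Max_in) auto
    then obtain m where "m < n" "Max (y ` {..<n}) = y m" by auto
    moreover have "y j \<le> Max (y ` {..<n})" if "j < n" for j using that by (intro Max_ge) auto
    ultimately show ?thesis by metis
  qed
  then obtain m where m: "m < n" "\<And>j. j < n \<Longrightarrow> y j \<le> y m" by blast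
  have ym: "0 < y m" using y m(1) .
  have R: "0 < R" using 1 y[OF i] by (smt (verit) mult_nonneg_nonpos)
  have "y i * R \<le> y m * R" using m(2)[OF i] R by (intro mult_right_mono) auto
  then have x: "1 / y m \<le> R" using 1 ym by (simp add: field_simps)
  define Q where "Q = (\<Prod>j\<in>{..<n}-{m}. [:1, - y j:])"
  have pQ: "p = [:1, - y m:] * Q"
    unfolding p Q_def using m(1) by (subst prod.remove[of _ m]) auto
  have "0 \<le> poly Q (1 / y m)"
    unfolding Q_def poly_prod using m(2) ym by (intro prod_nonneg) (auto simp: field_simps)
  moreover have "poly p (1 / y m) = 0" "poly (pderiv p) (1 / y m) = - y m * poly Q (1 / y m)"
    unfolding pQ pderiv_mult poly_add poly_mult using ym by (simp_all add: pderiv_pCons)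
  ultimately have "poly (euler_op \<kappa> p) (1 / y m) \<le> 0"
    unfolding poly_euler_op using ym assms(1) by simp
  with pos[OF _ x] ym show False by simp
qed

text \<open>The quotient is 1 - \<kappa> times the sum of y w / (1 - y w). Each term has real part
  at most its value at x = |w|, so the worst point is real. There \<delta> bounds p(x) (1 - \<kappa>
  T) from below with p(x) in (0, 1], and hence bounds both factors. The bound on |p(w)| later keeps
  the denominator away from 0 in the limit.\<close>

lemma Re_euler_quotient_ge:
  assumes \<kappa>: "0 < \<kappa>" and \<delta>: "0 < \<delta>"
    and ge: "\<And>x. 0 \<le> x \<Longrightarrow> x \<le> R \<Longrightarrow> \<delta> \<le> poly (euler_op \<kappa> p) x" and w: "cmod w \<le> R"
  shows "\<delta> \<le> cmod (poly (cpoly p) w)"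
    and "\<delta> \<le> Re (poly (cpoly (euler_op \<kappa> p)) w / poly (cpoly p) w)"
proof -
  define x where "x = cmod w"
  define T where "T = (\<Sum>i<n. y i * x / (1 - y i * x))"
  have x: "0 \<le> x" "x \<le> R" using w by (auto simp: x_def)
  have lt: "y i * x < 1" if "i < n" for i
  proof -
    have "y i * x \<le> y i * R" using x y[OF that] by (intro mult_left_mono) auto
    also have "y i * R < 1"
    proof (rule factor_less_1[OF \<kappa> _ that])
      fix x :: real assume "0 \<le> x" "x \<le> R"
      then show "0 < poly (euler_op \<kappa> p) x" using ge[of x] \<delta> by simp
    qed
    finally show ?thesis .
  qed
  have T: "0 \<le> T" unfolding T_def using lt x y by (intro sum_nonneg divide_nonneg_pos) (auto simp: less_imp_le)
  have px: "0 < poly p x" "poly p x \<le> 1"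
    unfolding poly_eq using lt x y by (auto intro!: prod_pos prod_le_1 simp: less_imp_le)
  have eu: "poly (euler_op \<kappa> p) x = poly p x * (1 - \<kappa> * T)"
    unfolding p T_def using lt by (intro poly_euler_op_linear_prod) force
  then have ge': "\<delta> \<le> poly p x * (1 - \<kappa> * T)" using ge[OF x] by simp
  have "0 \<le> 1 - \<kappa> * T" 
    using less_le_trans[OF \<delta> ge'] px(1) by (simp add: zero_less_mult_iff)
  then have "poly p x * (1 - \<kappa> * T) \<le> 1 - \<kappa> * T" using px by (simp add: mult_left_le_one_le)
  then have d1: "\<delta> \<le> 1 - \<kappa> * T" using ge' by simp
  have "poly p x * (1 - \<kappa> * T) \<le> poly p x"
    using px T \<kappa> by (intro mult_left_le) auto
  then have d2: "\<delta> \<le> poly p x" using ge' by simp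
  have ny: "cmod (of_real (y i) * w) = y i * x" if "i < n" for i
    using y[OF that] by (simp add: norm_mult x_def)
  have nf: "1 - y i * x \<le> cmod (1 - of_real (y i) * w)" if "i < n" for i
    using norm_triangle_ineq2[of 1 "of_real (y i) * w"] ny[OF that] by simp
  have nz: "1 - of_real (y i) * w \<noteq> 0" if "i < n" for i
    using nf[OF that] lt[OF that] by auto
  have cp: "poly (cpoly p) w = (\<Prod>i<n. 1 - of_real (y i) * w)"
    by (simp add: p cpoly_linear_prod poly_prod mult.commute)
  have "poly p x \<le> cmod (poly (cpoly p) w)"
    unfolding poly_eq cp prod_norm[symmetric]
    using nf lt by (intro prod_mono) (auto simp: less_imp_le)
  with d2 show "\<delta> \<le> cmod (poly (cpoly p) w)" by simp
  have "poly (cpoly (euler_op \<kappa> p)) w =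
      poly (cpoly p) w * (1 - of_real \<kappa> * (\<Sum>i<n. of_real (y i) * w / (1 - of_real (y i) * w)))"
    unfolding cpoly_euler_op p cpoly_linear_prod using nz by (intro poly_euler_op_linear_prod)
  moreover have "poly (cpoly p) w \<noteq> 0" unfolding cp using nz by simp
  ultimately have "Re (poly (cpoly (euler_op \<kappa> p)) w / poly (cpoly p) w) =
      1 - \<kappa> * (\<Sum>i<n. Re (of_real (y i) * w / (1 - of_real (y i) * w)))"
    by (simp add: Re_sum)
  moreover have "(\<Sum>i<n. Re (of_real (y i) * w / (1 - of_real (y i) * w))) \<le> T"
    unfolding T_def
  proof (intro sum_mono)
    fix i assume "i \<in> {..<n}"
    then have i: "i < n" by simp
    have "Re (of_real (y i) * w / (1 - of_real (y i) * w)) \<le>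
        cmod (of_real (y i) * w) / cmod (1 - of_real (y i) * w)"
      unfolding norm_divide[symmetric] by (rule complex_Re_le_cmod)
    also have "\<dots> \<le> y i * x / (1 - y i * x)"
      unfolding ny[OF i] using nf[OF i] lt[OF i] y[OF i] x by (intro frac_le) auto
    finally show "Re (of_real (y i) * w / (1 - of_real (y i) * w)) \<le> y i * x / (1 - y i * x)" .
  qed
  then have "\<kappa> * (\<Sum>i<n. Re (of_real (y i) * w / (1 - of_real (y i) * w))) \<le> \<kappa> * T"
    using \<kappa> by (intro mult_left_mono) auto
  ultimately show "\<delta> \<le> Re (poly (cpoly (euler_op \<kappa> p)) w / poly (cpoly p) w)" using d1 by simp
qed

end

subsection \<open>Limits of polynomials with positive roots\<close>

lemma positive_rooted_linear_factors:
  assumes "positive_rooted p"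
  obtains n y where "linear_factors n y p"
  using assms by (auto simp: linear_factors_def elim!: positive_rootedE)

text \<open>For the coefficients of an exponential the quotients in \<open>ratio\<close> are
  constant and nonzero; this assumption rules out such a factor in the limit.\<close>

locale positive_rooted_limit =
  fixes P :: "nat \<Rightarrow> real poly" and b :: "nat \<Rightarrow> real"
  assumes rooted: "\<And>N. positive_rooted (P N)"
    and lim: "\<And>k. (\<lambda>N. alt_coeff (P N) k) \<longlonglongrightarrow> b k"
    and pos: "\<And>k. 0 < b k"
    and ratio: "(\<lambda>k. real (k + 1) * b (k + 1) / b k) \<longlonglongrightarrow> 0"
begin

lemma power_sum_lims:
  "(\<lambda>N. power_sum2 (alt_coeff (P N))) \<longlonglongrightarrow> power_sum2 b"
  "(\<lambda>N. power_sum3 (alt_coeff (P N))) \<longlonglongrightarrow> power_sum3 b"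
  "(\<lambda>N. power_sum4 (alt_coeff (P N))) \<longlonglongrightarrow> power_sum4 b"
  unfolding power_sum2_def power_sum3_def power_sum4_def by (intro tendsto_intros lim)+

lemma power_sum_ineqs:
  "0 \<le> power_sum2 b" "0 \<le> power_sum3 b" "0 \<le> power_sum4 b"
  "power_sum2 b \<le> (b 1)\<^sup>2"
  "(power_sum2 b)\<^sup>2 \<le> b 1 * power_sum3 b"
  "(power_sum4 b)\<^sup>2 \<le> power_sum2 b * (power_sum3 b)\<^sup>2"
proof -
  have *: "0 \<le> power_sum2 (alt_coeff (P N))" "0 \<le> power_sum3 (alt_coeff (P N))"
    "0 \<le> power_sum4 (alt_coeff (P N))" "power_sum2 (alt_coeff (P N)) \<le> (alt_coeff (P N) 1)\<^sup>2"
    "(power_sum2 (alt_coeff (P N)))\<^sup>2 \<le> alt_coeff (P N) 1 * power_sum3 (alt_coeff (P N))"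
    "(power_sum4 (alt_coeff (P N)))\<^sup>2 \<le> power_sum2 (alt_coeff (P N)) * (power_sum3 (alt_coeff (P N)))\<^sup>2"
    for N
  proof -
    obtain n y where "linear_factors n y (P N)"
      using positive_rooted_linear_factors[OF rooted] .
    then interpret linear_factors n y "P N" .
    show "0 \<le> power_sum2 e" "0 \<le> power_sum3 e" "0 \<le> power_sum4 e" "power_sum2 e \<le> (e 1)\<^sup>2"
      "(power_sum2 e)\<^sup>2 \<le> e 1 * power_sum3 e" "(power_sum4 e)\<^sup>2 \<le> power_sum2 e * (power_sum3 e)\<^sup>2"
      by (fact power_sums_nonneg power_sum2_le power_sum2_square_le power_sum4_square_le)+
  qed
  show "0 \<le> power_sum2 b" "0 \<le> power_sum3 b" "0 \<le> power_sum4 b"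
    by (rule LIMSEQ_le_const[OF power_sum_lims(1)] LIMSEQ_le_const[OF power_sum_lims(2)]
        LIMSEQ_le_const[OF power_sum_lims(3)]; use * in blast)+
  show "power_sum2 b \<le> (b 1)\<^sup>2"
    by (rule LIMSEQ_le[OF power_sum_lims(1) tendsto_power[OF lim]]) (use * in blast)
  show "(power_sum2 b)\<^sup>2 \<le> b 1 * power_sum3 b"
    by (rule LIMSEQ_le[OF tendsto_power[OF power_sum_lims(1)] tendsto_mult[OF lim power_sum_lims(2)]])
      (use * in blast)
  show "(power_sum4 b)\<^sup>2 \<le> power_sum2 b * (power_sum3 b)\<^sup>2"
    by (rule LIMSEQ_le[OF tendsto_power[OF power_sum_lims(3)]
          tendsto_mult[OF power_sum_lims(1) tendsto_power[OF power_sum_lims(2)]]])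
      (use * in blast)
qed

text \<open>For finite products the expression is the sum of y^2 (y - c)^2. Limits only give a
  non-strict inequality, but equality would make the defect in \<open>recursion_defect\<close>
  vanish, and the resulting recursion contradicts \<open>ratio\<close>. All later strictness comes
  from particular choices of \<open>c\<close>.\<close>

lemma power_sum_variance_pos: "0 < power_sum4 b - 2 * c * power_sum3 b + c\<^sup>2 * power_sum2 b"
proof (rule ccontr)
  assume "\<not> ?thesis"
  then have D: "power_sum4 b - 2 * c * power_sum3 b + c\<^sup>2 * power_sum2 b \<le> 0" by simp
  define M where "M = c * b 1 - power_sum2 b"
  define q where "q k = real (k + 1) * b (k + 1) / b k" for k
  have q0: "q \<longlonglongrightarrow> 0" using ratio unfolding q_def .
  have rec: "real (k + 3) * b (k + 3) + c * real (k + 2) * b (k + 2) - b 1 * b (k + 2)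
     - M * b (k + 1) = 0" for k
  proof -
    have "(real (k + 3) * b (k + 3) + c * real (k + 2) * b (k + 2) - b 1 * b (k + 2)
        - M * b (k + 1))\<^sup>2
      \<le> (power_sum4 b - 2 * c * power_sum3 b + c\<^sup>2 * power_sum2 b) * (power_sum2 b * (b k)\<^sup>2)"
    proof (rule LIMSEQ_le)
      let ?e = "\<lambda>N. alt_coeff (P N)"
      show "(\<lambda>N. (real (k + 3) * ?e N (k + 3) + c * real (k + 2) * ?e N (k + 2) - ?e N 1 * ?e N (k + 2)
          - (c * ?e N 1 - power_sum2 (?e N)) * ?e N (k + 1))\<^sup>2)
        \<longlonglongrightarrow> (real (k + 3) * b (k + 3) + c * real (k + 2) * b (k + 2) - b 1 * b (k + 2)
        - M * b (k + 1))\<^sup>2"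
        unfolding M_def by (intro tendsto_intros lim power_sum_lims)
      show "(\<lambda>N. (power_sum4 (?e N) - 2 * c * power_sum3 (?e N) + c\<^sup>2 * power_sum2 (?e N))
          * (power_sum2 (?e N) * (?e N k)\<^sup>2))
        \<longlonglongrightarrow> (power_sum4 b - 2 * c * power_sum3 b + c\<^sup>2 * power_sum2 b) * (power_sum2 b * (b k)\<^sup>2)"
        by (intro tendsto_intros lim power_sum_lims)
      have "(real (k + 3) * ?e N (k + 3) + c * real (k + 2) * ?e N (k + 2) - ?e N 1 * ?e N (k + 2)
          - (c * ?e N 1 - power_sum2 (?e N)) * ?e N (k + 1))\<^sup>2
        \<le> (power_sum4 (?e N) - 2 * c * power_sum3 (?e N) + c\<^sup>2 * power_sum2 (?e N))
          * (power_sum2 (?e N) * (?e N k)\<^sup>2)" for N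
      proof -
        obtain n y where "linear_factors n y (P N)"
          using positive_rooted_linear_factors[OF rooted] .
        then show ?thesis by (rule linear_factors.recursion_defect)
      qed
      then show "\<exists>N0. \<forall>N\<ge>N0. (real (k + 3) * ?e N (k + 3) + c * real (k + 2) * ?e N (k + 2) - ?e N 1 * ?e N (k + 2)
          - (c * ?e N 1 - power_sum2 (?e N)) * ?e N (k + 1))\<^sup>2
        \<le> (power_sum4 (?e N) - 2 * c * power_sum3 (?e N) + c\<^sup>2 * power_sum2 (?e N))
          * (power_sum2 (?e N) * (?e N k)\<^sup>2)" by blast
    qed
    also have "\<dots> \<le> 0"
      using D power_sum_ineqs(1) by (intro mult_nonpos_nonneg) auto
    finally show ?thesis by simp
  qed
  have step: "real (k + 3) * b (k + 3) = q (k + 2) * b (k + 2)"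
    "real (k + 2) * b (k + 2) = q (k + 1) * b (k + 1)" for k
    using pos[of "k + 2"] pos[of "k + 1"] by (auto simp: q_def eval_nat_numeral)
  \<comment> \<open>Divided by \<open>b (k + 1)\<close>, the recursion expresses the constant
    \<open>M\<close> through terms that tend to 0.\<close>
  have "M = 0"
  proof -
    have "q (k + 2) * (q (k + 1) / real (k + 2)) + c * q (k + 1) - b 1 * (q (k + 1) / real (k + 2)) = M" for k
    proof -
      have b2: "b (k + 2) = q (k + 1) / real (k + 2) * b (k + 1)"
        using step(2)[of k] by (simp add: field_simps)
      have "q (k + 2) * b (k + 2) + c * (q (k + 1) * b (k + 1)) - b 1 * b (k + 2) - M * b (k + 1) = 0"
        using rec[of k] by (simp only: step(1) step(2) mult.assoc)
      then have "(q (k + 2) * (q (k + 1) / real (k + 2)) + c * q (k + 1)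
          - b 1 * (q (k + 1) / real (k + 2)) - M) * b (k + 1) = 0"
        unfolding b2 by (simp only: algebra_simps)
      then show ?thesis using pos[of "k + 1"] by simp
    qed
    moreover
    have q1: "(\<lambda>k. q (k + 2)) \<longlonglongrightarrow> 0" "(\<lambda>k. q (k + 1)) \<longlonglongrightarrow> 0"
      using q0 by (rule LIMSEQ_ignore_initial_segment)+
    have "(\<lambda>k. q (k + 1) / real (k + 2)) \<longlonglongrightarrow> 0"
      by (intro real_tendsto_divide_at_top[OF q1(2)]
          filterlim_compose[OF filterlim_real_sequentially] filterlim_add_const_nat_at_top)
    then have "(\<lambda>k. q (k + 2) * (q (k + 1) / real (k + 2)) + c * q (k + 1)
        - b 1 * (q (k + 1) / real (k + 2))) \<longlonglongrightarrow> 0 * 0 + c * 0 - b 1 * 0"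
      using q1 by (intro tendsto_diff tendsto_add tendsto_mult tendsto_const)
    ultimately show "M = 0" by (simp add: LIMSEQ_const_iff)
  qed
  have q_eq: "q (k + 2) = b 1 - c * real (k + 2)" for k
  proof -
    have "q (k + 2) * b (k + 2) + c * real (k + 2) * b (k + 2) - b 1 * b (k + 2) = 0"
      using rec[of k] \<open>M = 0\<close> by (simp only: step(1) mult_zero_left diff_zero)
    then have "(q (k + 2) + c * real (k + 2) - b 1) * b (k + 2) = 0"
      by (simp only: algebra_simps)
    then show ?thesis using pos[of "k + 2"] by simp
  qed
  \<comment> \<open>By \<open>q_eq\<close>, \<open>q\<close> is affine in the index, yet it tends to
    0: so slope and constant term vanish, against \<open>b 1\<close> > 0.\<close>
  have "(\<lambda>k. q (k + 2) - q (k + 3)) \<longlonglongrightarrow> 0 - 0"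
    using q0 by (intro tendsto_diff LIMSEQ_ignore_initial_segment)
  moreover have "q (k + 2) - q (k + 3) = c" for k
    using q_eq[of k] q_eq[of "Suc k"] by (simp add: eval_nat_numeral algebra_simps)
  ultimately have "c = 0" by (simp add: LIMSEQ_const_iff)
  then have "(\<lambda>k. b 1) \<longlonglongrightarrow> 0"
    using LIMSEQ_ignore_initial_segment[OF q0, of 2] q_eq by simp
  then show False using pos[of 1] by (simp add: LIMSEQ_const_iff)
qed

lemma power_sums_pos: "0 < power_sum2 b" "0 < power_sum3 b" "0 < power_sum4 b"
proof -
  show 4: "0 < power_sum4 b" using power_sum_variance_pos[of 0] by simp
  have "0 < (power_sum4 b)\<^sup>2" using 4 by simp
  also have "\<dots> \<le> power_sum2 b * (power_sum3 b)\<^sup>2" by (fact power_sum_ineqs)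
  finally show "0 < power_sum2 b" "0 < power_sum3 b"
    using power_sum_ineqs(1,2) by (auto simp: zero_less_mult_iff less_le)
qed

text \<open>With c the square root of the second power sum S2, the bound S4 \<le> c S3 turns the
  positive variance into S2^2 - S4 > 0.\<close>

lemma power_sum4_less: "power_sum4 b < (power_sum2 b)\<^sup>2"
proof -
  let ?c = "sqrt (power_sum2 b)"
  have "(power_sum4 b)\<^sup>2 \<le> (?c * power_sum3 b)\<^sup>2"
    using power_sum_ineqs(1,6) by (simp add: power_mult_distrib)
  then have "power_sum4 b \<le> ?c * power_sum3 b"
    using power_sums_pos by (rule_tac power2_le_imp_le) auto
  moreover have "0 < power_sum4 b - 2 * ?c * power_sum3 b + ?c\<^sup>2 * power_sum2 b"
    by (rule power_sum_variance_pos)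
  moreover have "?c\<^sup>2 * power_sum2 b = (power_sum2 b)\<^sup>2"
    using power_sum_ineqs(1) by (simp add: power2_eq_square)
  ultimately show ?thesis by linarith
qed

text \<open>The chosen \<open>c\<close> minimizes the variance, whose positivity then reads S3^2 <
  S2 S4.\<close>

lemma power_sum3_quotient_less: "power_sum3 b / power_sum4 b < power_sum2 b / power_sum3 b"
proof -
  let ?c = "power_sum3 b / power_sum2 b"
  have "0 < power_sum4 b - 2 * ?c * power_sum3 b + ?c\<^sup>2 * power_sum2 b"
    by (rule power_sum_variance_pos)
  then show ?thesis using power_sums_pos by (simp add: field_simps power2_eq_square)
qed

lemma eventually_ge:
  assumes t: "0 \<le> t" "power_sum4 b * t ^ 4 < 1"
  obtains \<delta> where "0 < \<delta>"
    "eventually (\<lambda>N. \<forall>x. 0 \<le> x \<longrightarrow> x \<le> t \<longrightarrow> \<delta> \<le> poly (P N) x) sequentially"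
proof -
  \<comment> \<open>A margin strictly between the limit value and 1 provides one \<open>s\<close> <
    1, hence one \<delta>, for all large N.\<close>
  define v where "v = (1 + power_sum4 b * t ^ 4) / 2"
  have v: "0 \<le> v" "v < 1" "power_sum4 b * t ^ 4 < v"
    using t power_sum_ineqs(3) by (auto simp: v_def)
  define s where "s = root 4 v"
  have s: "0 \<le> s" "s < 1" "s ^ 4 = v"
    using v by (auto simp: s_def)
  define \<delta> where "\<delta> = exp (- ((b 1 + 1) * t / (1 - s)))"
  show thesis
  proof (rule that)
    show "0 < \<delta>" by (simp add: \<delta>_def)
    have "eventually (\<lambda>N. power_sum4 (alt_coeff (P N)) * t ^ 4 < v) sequentially"
      using v(3) by (intro order_tendstoD(2)[OF tendsto_mult_right[OF power_sum_lims(3)]])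
    moreover have "eventually (\<lambda>N. alt_coeff (P N) 1 < b 1 + 1) sequentially"
      by (rule order_tendstoD(2)[OF lim]) simp
    ultimately show "eventually (\<lambda>N. \<forall>x. 0 \<le> x \<longrightarrow> x \<le> t \<longrightarrow> \<delta> \<le> poly (P N) x) sequentially"
    proof eventually_elim
      case (elim N)
      obtain n y where "linear_factors n y (P N)"
        using positive_rooted_linear_factors[OF rooted] .
      then interpret linear_factors n y "P N" .
      have "\<delta> \<le> exp (- (e 1 * t / (1 - s)))"
        using elim(2) t s by (simp add: \<delta>_def divide_right_mono mult_right_mono)
      moreover have "exp (- (e 1 * t / (1 - s))) \<le> poly (P N) x" if "0 \<le> x" "x \<le> t" for x
        using elim(1) s that by (intro poly_ge_exp) auto
      ultimately show ?case by (meson order_trans)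
    qed
  qed
qed

lemma eventually_root:
  assumes "power_sum3 b / power_sum4 b < B"
  shows "eventually (\<lambda>N. \<exists>x. 0 < x \<and> x \<le> B \<and> poly (P N) x = 0) sequentially"
proof -
  have "eventually (\<lambda>N. 0 < power_sum3 (alt_coeff (P N))) sequentially"
    "eventually (\<lambda>N. 0 < power_sum4 (alt_coeff (P N))) sequentially"
    by (rule order_tendstoD(1)[OF power_sum_lims(2)] order_tendstoD(1)[OF power_sum_lims(3)];
        rule power_sums_pos)+
  moreover have "eventually (\<lambda>N. power_sum3 (alt_coeff (P N)) / power_sum4 (alt_coeff (P N)) < B) sequentially"
    using power_sums_pos(3)
    by (intro order_tendstoD(2)[OF tendsto_divide[OF power_sum_lims(2,3)] _ ] assms) simp
  ultimately show ?thesis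
  proof eventually_elim
    case (elim N)
    obtain n y where "linear_factors n y (P N)"
      using positive_rooted_linear_factors[OF rooted] .
    from linear_factors.ex_root_le[OF this elim(1)] obtain x where
      x: "0 < x" "x * power_sum4 (alt_coeff (P N)) \<le> power_sum3 (alt_coeff (P N))" "poly (P N) x = 0"
      by blast
    have "x \<le> power_sum3 (alt_coeff (P N)) / power_sum4 (alt_coeff (P N))"
      using x(2) elim(2) by (simp add: field_simps)
    then show ?case using elim(3) x by (intro exI[of _ x]) auto
  qed
qed

end

section \<open>From convergence of coefficients to convergence of values\<close>

lemma tannery_sequence:
  fixes u :: "nat \<Rightarrow> nat \<Rightarrow> 'a::{real_normed_algebra, banach}"
  assumes "\<And>k. (\<lambda>N. u N k) \<longlonglongrightarrow> v k" "\<And>N k. norm (u N k) \<le> M k" "summable M"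
  shows "summable (\<lambda>k. norm (v k))" "(\<lambda>N. \<Sum>k. u N k) \<longlonglongrightarrow> (\<Sum>k. v k)"
proof -
  have "eventually (\<lambda>(k, N). norm (u N k) \<le> M k) (at_top \<times>\<^sub>F sequentially)"
    using assms(2) by (intro always_eventually) auto
  from tannerys_theorem[where a = "\<lambda>k N. u N k", OF assms(1) this assms(3)]
  show "summable (\<lambda>k. norm (v k))" "(\<lambda>N. \<Sum>k. u N k) \<longlonglongrightarrow> (\<Sum>k. v k)" by auto
qed

lemma poly_sums:
  fixes p :: "'a::{comm_ring_1, real_normed_algebra_1} poly"
  shows "(\<lambda>k. coeff p k * x ^ k) sums poly p x"
proof -
  have "(\<lambda>k. coeff p k * x ^ k) sums (\<Sum>k\<in>{..degree p}. coeff p k * x ^ k)"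
    by (rule sums_finite) (auto simp: coeff_eq_0)
  then show ?thesis by (simp add: poly_altdef)
qed

locale entire_limit =
  fixes p :: "nat \<Rightarrow> real poly" and c M :: "nat \<Rightarrow> real"
  assumes coeff_lim: "\<And>k. (\<lambda>N. coeff (p N) k) \<longlonglongrightarrow> c k"
    and coeff_bound: "\<And>N k. \<bar>coeff (p N) k\<bar> \<le> M k"
    and summable_bound: "\<And>r. 0 \<le> r \<Longrightarrow> summable (\<lambda>k. M k * r ^ k)"
begin

lemma cpoly_lim: "(\<lambda>N. poly (cpoly (p N)) w) \<longlonglongrightarrow> (\<Sum>k. of_real (c k) * w ^ k)"
  and summable_series: "summable (\<lambda>k. complex_of_real (c k) * w ^ k)"
proof -
  have *: "(\<lambda>N. complex_of_real (coeff (p N) k) * w ^ k) \<longlonglongrightarrow> of_real (c k) * w ^ k"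
    "cmod (complex_of_real (coeff (p N) k) * w ^ k) \<le> M k * cmod w ^ k" for k N
    by (intro tendsto_intros coeff_lim)
      (simp add: norm_mult norm_power mult_right_mono coeff_bound)
  note t = tannery_sequence[OF * summable_bound[OF norm_ge_zero]]
  have "(\<Sum>k. complex_of_real (coeff (p N) k) * w ^ k) = poly (cpoly (p N)) w" for N
    using sums_unique[OF poly_sums[of "cpoly (p N)" w]] by (simp add: coeff_map_poly)
  with t(2) show "(\<lambda>N. poly (cpoly (p N)) w) \<longlonglongrightarrow> (\<Sum>k. of_real (c k) * w ^ k)" by simp
  show "summable (\<lambda>k. complex_of_real (c k) * w ^ k)" using t(1) by (rule summable_norm_cancel)
qed

lemma summable_real_series: "summable (\<lambda>k. c k * x ^ k)"
  using summable_series[of "of_real x"] by (simp flip: of_real_power of_real_mult add: summable_of_real_iff)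

text \<open>On |x| \<le> R the error is at most the sum of the coefficient errors times R^k; this no
  longer depends on x and tends to 0 by domination with 2 M_k R^k.\<close>

lemma uniform_poly_lim:
  assumes "0 \<le> R" "0 < \<epsilon>"
  shows "eventually (\<lambda>N. \<forall>x. \<bar>x\<bar> \<le> R \<longrightarrow> \<bar>poly (p N) x - (\<Sum>k. c k * x ^ k)\<bar> < \<epsilon>) sequentially"
proof -
  have cM: "\<bar>c k\<bar> \<le> M k" for k
    by (rule LIMSEQ_le_const2[OF tendsto_rabs[OF coeff_lim]]) (use coeff_bound in blast)
  define u where "u N k = \<bar>coeff (p N) k - c k\<bar> * R ^ k" for N k
  have u0: "(\<lambda>N. u N k) \<longlonglongrightarrow> \<bar>c k - c k\<bar> * R ^ k" for k
    unfolding u_def by (intro tendsto_intros coeff_lim)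
  have uM: "norm (u N k) \<le> 2 * (M k * R ^ k)" for N k
  proof -
    have "\<bar>coeff (p N) k - c k\<bar> \<le> 2 * M k"
      using coeff_bound[of N k] cM[of k] by linarith
    then have "\<bar>coeff (p N) k - c k\<bar> * R ^ k \<le> 2 * M k * R ^ k"
      using assms(1) by (intro mult_right_mono) auto
    then show ?thesis using assms(1) by (simp add: u_def abs_mult)
  qed
  have sM: "summable (\<lambda>k. 2 * (M k * R ^ k))"
    using summable_bound[OF assms(1)] by (rule summable_mult)
  have "(\<lambda>N. \<Sum>k. u N k) \<longlonglongrightarrow> 0" using tannery_sequence(2)[OF u0 uM sM] by simp
  then have "eventually (\<lambda>N. (\<Sum>k. u N k) < \<epsilon>) sequentially"
    using assms(2) by (rule order_tendstoD)
  then show ?thesis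
  proof (eventually_elim, intro allI impI)
    fix N x assume N: "(\<Sum>k. u N k) < \<epsilon>" and x: "\<bar>x\<bar> \<le> R"
    have su: "summable (u N)"
      by (rule summable_comparison_test'[OF sM]) (rule uM)
    have le: "\<bar>(coeff (p N) k - c k) * x ^ k\<bar> \<le> u N k" for k
      unfolding u_def abs_mult power_abs using x by (intro mult_left_mono power_mono) auto
    have "(\<lambda>k. coeff (p N) k * x ^ k - c k * x ^ k) sums (poly (p N) x - (\<Sum>k. c k * x ^ k))"
      by (intro sums_diff poly_sums summable_sums summable_real_series)
    then have "poly (p N) x - (\<Sum>k. c k * x ^ k) = (\<Sum>k. (coeff (p N) k - c k) * x ^ k)"
      by (simp add: sums_iff algebra_simps)
    also have "\<bar>\<dots>\<bar> \<le> (\<Sum>k. u N k)"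
      using norm_suminf_le[OF _ su, of "\<lambda>k. (coeff (p N) k - c k) * x ^ k"] le by simp
    finally show "\<bar>poly (p N) x - (\<Sum>k. c k * x ^ k)\<bar> < \<epsilon>" using N by simp
  qed
qed

lemma continuous_real_series: "isCont (\<lambda>x. \<Sum>k. c k * x ^ k) x"
  using termdiffs_strong_converges_everywhere[OF summable_real_series] by (rule DERIV_isCont)

end

section \<open>Starlikeness of z f(z^2) for a limit f of products with positive zeros\<close>

locale laguerre_limit =
  fixes F :: "nat \<Rightarrow> real poly" and a M :: "nat \<Rightarrow> real"
  assumes F_rooted: "\<And>N. positive_rooted (F N)"
    and F_lim: "\<And>k. (\<lambda>N. alt_coeff (F N) k) \<longlonglongrightarrow> a k"
    and F_bound: "\<And>N k. \<bar>alt_coeff (F N) k\<bar> \<le> M k"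
    and F_summable: "\<And>r. 0 \<le> r \<Longrightarrow> summable (\<lambda>k. M k * r ^ k)"
    and a_pos: "\<And>k. 0 < a k"
    and a_ratio: "(\<lambda>k. real (k + 1) * a (k + 1) / a k) \<longlonglongrightarrow> 0"
begin

definition b :: "nat \<Rightarrow> real" where "b k = (1 + 2 * real k) * a k"
definition ca :: "nat \<Rightarrow> real" where "ca k = (-1) ^ k * a k"
definition cb :: "nat \<Rightarrow> real" where "cb k = (-1) ^ k * b k"

definition f :: "complex \<Rightarrow> complex" where "f w = (\<Sum>k. of_real (ca k) * w ^ k)"
definition \<psi> :: "complex \<Rightarrow> complex" where "\<psi> w = (\<Sum>k. of_real (cb k) * w ^ k)"

abbreviation P :: "nat \<Rightarrow> real poly" where "P N \<equiv> euler_op 2 (F N)"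

lemma coeff_F: "coeff (F N) k = (-1) ^ k * alt_coeff (F N) k"
  by (simp add: alt_coeff_def flip: mult.assoc power_mult_distrib)

lemma coeff_P: "coeff (P N) k = (1 + 2 * real k) * coeff (F N) k"
  by (simp add: coeff_euler_op)

lemma alt_coeff_P: "alt_coeff (P N) k = (1 + 2 * real k) * alt_coeff (F N) k"
  by (simp add: alt_coeff_def coeff_P)

sublocale F: entire_limit F ca M
proof
  show "(\<lambda>N. coeff (F N) k) \<longlonglongrightarrow> ca k" for k
    unfolding coeff_F ca_def by (intro tendsto_intros F_lim)
  show "\<bar>coeff (F N) k\<bar> \<le> M k" for N k
    using F_bound[of N k] by (simp add: coeff_F abs_mult)
qed (fact F_summable)

sublocale P: entire_limit P cb "\<lambda>k. 3 ^ k * M k"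
proof
  show "(\<lambda>N. coeff (P N) k) \<longlonglongrightarrow> cb k" for k
    unfolding coeff_P coeff_F cb_def b_def mult.left_commute[of _ "(-1) ^ k"]
    by (intro tendsto_intros F_lim)
  show "\<bar>coeff (P N) k\<bar> \<le> 3 ^ k * M k" for N k
  proof -
    \<comment> \<open>The factor from the Euler operator is absorbed into a geometric one, which is
      harmless because \<open>M\<close> is summable against every \<open>r ^ k\<close>.\<close>
    have "1 + 2 * real k \<le> 3 ^ k" using Bernoulli_inequality[of 2 k] by (simp add: mult.commute)
    then have "(1 + 2 * real k) * \<bar>coeff (F N) k\<bar> \<le> 3 ^ k * M k"
      by (intro mult_mono F.coeff_bound) auto
    then show ?thesis by (simp add: coeff_P abs_mult)
  qed
  show "summable (\<lambda>k. 3 ^ k * M k * r ^ k)" if "0 \<le> r" for r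
    using F_summable[of "3 * r"] that by (simp add: power_mult_distrib mult_ac)
qed

text \<open>The power sums are those of \<open>P N\<close> and not of \<open>F N\<close>, because
  the zeros of \<psi> determine where starlikeness fails.\<close>

sublocale positive_rooted_limit P b
proof
  show "positive_rooted (P N)" for N by (intro positive_rooted_euler_op F_rooted) simp
  show "(\<lambda>N. alt_coeff (P N) k) \<longlonglongrightarrow> b k" for k
    unfolding alt_coeff_P b_def by (intro tendsto_intros F_lim)
  show "0 < b k" for k using a_pos[of k] by (simp add: b_def)
  have "(\<lambda>k. real (k + 1) * a (k + 1) / a k * ((1 + 2 * real (k + 1)) / (1 + 2 * real k))) \<longlonglongrightarrow> 0 * 1"
  proof (rule tendsto_mult[OF a_ratio])
    have "filterlim (\<lambda>k. 1 + 2 * real k) at_top sequentially"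
      by (rule filterlim_tendsto_add_at_top[OF tendsto_const filterlim_tendsto_pos_mult_at_top[OF
            tendsto_const zero_less_numeral filterlim_real_sequentially]])
    then have "(\<lambda>k. 1 + 2 / (1 + 2 * real k)) \<longlonglongrightarrow> 1 + 0"
      by (rule tendsto_add[OF tendsto_const real_tendsto_divide_at_top[OF tendsto_const]])
    moreover have "1 + 2 / (1 + 2 * real k) = (1 + 2 * real (k + 1)) / (1 + 2 * real k)" for k
      by (simp add: divide_simps)
    ultimately show "(\<lambda>k. (1 + 2 * real (k + 1)) / (1 + 2 * real k)) \<longlonglongrightarrow> 1" by simp
  qed
  then show "(\<lambda>k. real (k + 1) * b (k + 1) / b k) \<longlonglongrightarrow> 0" by (simp add: b_def mult_ac)
qed

abbreviation g :: "complex \<Rightarrow> complex" where "g z \<equiv> z * f (z\<^sup>2)"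

lemma deriv_g: "deriv g z = \<psi> (z\<^sup>2)"
proof -
  let ?D = "\<lambda>w. \<Sum>k. diffs (\<lambda>k. of_real (ca k)) k * (w::complex) ^ k"
  have f': "(f has_field_derivative ?D w) (at w)" for w
    unfolding f_def[abs_def] by (rule termdiffs_strong_converges_everywhere[OF F.summable_series])
  have "(g has_field_derivative (f (z\<^sup>2) + z * (?D (z\<^sup>2) * (2 * z)))) (at z)"
    by (auto intro!: derivative_eq_intros DERIV_chain2[OF f'])
  then have "deriv g z = f (z\<^sup>2) + 2 * (z\<^sup>2 * ?D (z\<^sup>2))"
    by (auto dest!: DERIV_imp_deriv simp: power2_eq_square algebra_simps)
  moreover have "f w + 2 * (w * ?D w) = \<psi> w" for w
  proof -
    have "summable (\<lambda>k. diffs (\<lambda>k. of_real (ca k)) k * w ^ k)"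
      by (rule termdiff_converges_all) (rule F.summable_series)
    from sums_mult[OF diffs_equiv[OF this], of w]
    have "(\<lambda>k. of_nat k * of_real (ca k) * w ^ k) sums (w * ?D w)"
    proof (rule sums_cong[THEN iffD1, rotated])
      \<comment> \<open>The exponent k - 1 is truncated at k = 0, where the factor
        \<open>of_nat k\<close> kills the term.\<close>
      show "w * (of_nat k * of_real (ca k) * w ^ (k - Suc 0)) = of_nat k * of_real (ca k) * w ^ k" for k
        by (cases k) (simp_all add: algebra_simps)
    qed
    from sums_add[OF summable_sums[OF F.summable_series] sums_mult[OF this, of 2]]
    have "(\<lambda>k. of_real (cb k) * w ^ k) sums (f w + 2 * (w * ?D w))"
      by (simp add: f_def cb_def ca_def b_def algebra_simps)
    then show ?thesis unfolding \<psi>_def by (simp add: sums_iff)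
  qed
  ultimately show ?thesis by simp
qed

lemma starlike_quotient_g: "starlike_quotient g z = \<psi> (z\<^sup>2) / f (z\<^sup>2)"
proof (cases "z = 0")
  case True
  have "f 0 = of_real (a 0)" "\<psi> 0 = of_real (a 0)"
    unfolding f_def \<psi>_def ca_def cb_def b_def by (subst powser_zero; simp)+
  then show ?thesis using True a_pos[of 0] by (simp add: starlike_quotient_def)
qed (simp add: starlike_quotient_def deriv_g)

text \<open>The same \<delta> bounds |F_N(w)| and the real part of the quotient for all large N; the
  first bound gives f(w) \<noteq> 0, so the second passes to the limit.\<close>

lemma starlike_quotient_g_pos:
  assumes t: "0 \<le> t" "power_sum4 b * t ^ 4 < 1" and w: "cmod w \<le> t"
  shows "0 < Re (\<psi> w / f w)"
proof -
  obtain \<delta> where \<delta>: "0 < \<delta>"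
    and ev: "eventually (\<lambda>N. \<forall>x. 0 \<le> x \<longrightarrow> x \<le> t \<longrightarrow> \<delta> \<le> poly (P N) x) sequentially"
    using eventually_ge[OF t] .
  have *: "\<delta> \<le> cmod (poly (cpoly (F N)) w) \<and> \<delta> \<le> Re (poly (cpoly (P N)) w / poly (cpoly (F N)) w)"
    if N: "\<forall>x. 0 \<le> x \<longrightarrow> x \<le> t \<longrightarrow> \<delta> \<le> poly (P N) x" for N
  proof -
    obtain n y where lf: "linear_factors n y (F N)"
      using positive_rooted_linear_factors[OF F_rooted] .
    show ?thesis
      using linear_factors.Re_euler_quotient_ge[OF lf _ \<delta> _ w, of 2] N by simp
  qed
  have fl: "(\<lambda>N. poly (cpoly (F N)) w) \<longlonglongrightarrow> f w" unfolding f_def by (rule F.cpoly_lim)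
  have pl: "(\<lambda>N. poly (cpoly (P N)) w) \<longlonglongrightarrow> \<psi> w" unfolding \<psi>_def by (rule P.cpoly_lim)
  have "\<delta> \<le> cmod (f w)"
    by (rule tendsto_lowerbound[OF tendsto_norm[OF fl]])
      (use eventually_mono[OF ev] * in \<open>auto elim!: eventually_mono\<close>)
  then have "f w \<noteq> 0" using \<delta> by auto
  then have "\<delta> \<le> Re (\<psi> w / f w)"
    by (intro tendsto_lowerbound[OF tendsto_Re[OF tendsto_divide[OF pl fl]]])
      (use eventually_mono[OF ev] * in \<open>auto elim!: eventually_mono\<close>)
  then show ?thesis using \<delta> by simp
qed

text \<open>Otherwise \<psi> is positive on the compact interval from 0 to \<open>B\<close>, with a
  positive minimum. Uniform approximation within that minimum makes \<open>P N\<close> positive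
  there too, against \<open>eventually_root\<close>.\<close>

lemma ex_real_root:
  assumes B: "power_sum3 b / power_sum4 b < B"
  shows "\<exists>x>0. x \<le> B \<and> \<psi> (of_real x) = 0"
proof (rule ccontr)
  assume no: "\<not> ?thesis"
  define h where "h x = (\<Sum>k. cb k * x ^ k)" for x
  have \<psi>h: "\<psi> (of_real x) = of_real (h x)" for x
    unfolding \<psi>_def h_def suminf_of_real[OF P.summable_real_series] by simp
  have B0: "0 \<le> B" using divide_pos_pos[OF power_sums_pos(2,3)] B by simp
  have h0: "0 < h 0" unfolding h_def using pos[of 0] by (subst powser_zero) (simp add: cb_def)
  have cont: "isCont h x" for x unfolding h_def[abs_def] by (rule P.continuous_real_series)
  have hpos: "0 < h x" if x: "0 \<le> x" "x \<le> B" for x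
  proof (rule ccontr)
    assume "\<not> 0 < h x"
    then have "\<exists>z\<ge>0. z \<le> x \<and> h z = 0"
      using h0 x cont by (intro IVT2) auto
    then obtain z where z: "0 \<le> z" "z \<le> x" "h z = 0" by blast
    with h0 have "0 < z" by (cases "z = 0") auto
    then show False using no z x \<psi>h[of z] by (metis of_real_0 order_trans)
  qed
  obtain xm where xm: "0 \<le> xm" "xm \<le> B" "\<And>x. 0 \<le> x \<Longrightarrow> x \<le> B \<Longrightarrow> h xm \<le> h x"
    using continuous_attains_inf[of "{0..B}" h] B0 cont
    by (auto simp: continuous_at_imp_continuous_on)
  have "eventually (\<lambda>N. \<forall>x. \<bar>x\<bar> \<le> B \<longrightarrow> \<bar>poly (P N) x - h x\<bar> < h xm) sequentially"
    unfolding h_def using B0 hpos[OF xm(1,2)] by (intro P.uniform_poly_lim) (simp_all add: h_def)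
  then have "eventually (\<lambda>N. False) sequentially"
    using eventually_root[OF B]
  proof eventually_elim
    case (elim N)
    then obtain x where x: "0 < x" "x \<le> B" "poly (P N) x = 0" by blast
    have "\<bar>poly (P N) x - h x\<bar> < h xm"
      using elim(1)[rule_format, of x] x(1,2) by simp
    then show ?case using x xm(3)[of x] by (smt (verit))
  qed
  then show False by simp
qed

text \<open>Strictness comes from the gap between S2^(-1/2) and S4^(-1/4): any \<open>t\<close>
  inside it still gives an admissible radius \<open>sqrt t\<close>.\<close>

lemma starlikeness_radius_lower: "ereal (root 4 (1 / power_sum2 b)) < starlikeness_radius g"
proof -
  let ?S = "power_sum2 b" let ?T = "power_sum4 b"
  have "1 / ?S\<^sup>2 < 1 / ?T"
    using power_sums_pos power_sum4_less by (simp add: frac_less2)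
  then have "root 2 (1 / ?S) < root 4 (1 / ?T)"
  proof -
    have "root 2 (1 / ?S) = root 4 ((1 / ?S)\<^sup>2)"
      using power_sums_pos(1) real_root_mult_exp[of 2 2 "(1 / ?S)\<^sup>2"]
      by (simp add: real_root_power_cancel)
    also have "\<dots> < root 4 (1 / ?T)"
      using \<open>1 / ?S\<^sup>2 < 1 / ?T\<close> by (intro real_root_less_mono) (simp_all add: power_divide)
    finally show ?thesis .
  qed
  then obtain t where t: "root 2 (1 / ?S) < t" "t < root 4 (1 / ?T)" using dense by blast
  have t0: "0 < t" using less_trans[OF real_root_gt_zero[of 2 "1 / ?S"] t(1)] power_sums_pos(1) by simp
  have "t ^ 4 < root 4 (1 / ?T) ^ 4" using t t0 by (intro power_strict_mono) auto
  then have t4: "?T * t ^ 4 < 1" using power_sums_pos(3) by (simp add: field_simps)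
  have "root 4 (1 / ?S) = sqrt (root 2 (1 / ?S))"
    using real_root_mult_exp[of 2 2 "1 / ?S"] by (simp add: sqrt_def)
  also have "\<dots> < sqrt t" using t(1) by simp
  finally have "ereal (root 4 (1 / ?S)) < ereal (sqrt t)" by simp
  also have "ereal (sqrt t) \<le> starlikeness_radius g"
    unfolding starlikeness_radius_def
  proof (rule SUP_upper, safe)
    show "0 < sqrt t" using t0 by simp
    fix z :: complex assume "z \<in> ball 0 (sqrt t)"
    then have "(cmod z)\<^sup>2 \<le> (sqrt t)\<^sup>2" by (intro power_mono) auto
    then have "cmod (z\<^sup>2) \<le> t" using t0 by (simp add: norm_power)
    then show "0 < Re (starlike_quotient g z)"
      unfolding starlike_quotient_g using t0 t4 by (intro starlike_quotient_g_pos) auto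
  qed
  finally show ?thesis .
qed

text \<open>Again a gap gives strictness: a zero x of \<psi> lies below some \<open>B\<close> < S2 /
  S3, and the quotient vanishes at the square root of x.\<close>

lemma starlikeness_radius_upper:
  "starlikeness_radius g < ereal (sqrt (power_sum2 b / power_sum3 b))"
proof -
  obtain B where B: "power_sum3 b / power_sum4 b < B" "B < power_sum2 b / power_sum3 b"
    using dense[OF power_sum3_quotient_less] by blast
  obtain x where x: "0 < x" "x \<le> B" "\<psi> (of_real x) = 0" using ex_real_root[OF B(1)] by blast
  have "starlikeness_radius g \<le> ereal (sqrt B)"
    unfolding starlikeness_radius_def
  proof (rule SUP_least, safe)
    fix r assume r: "\<forall>z\<in>ball 0 r. 0 < Re (starlike_quotient g z)"
    have "starlike_quotient g (of_real (sqrt x)) = 0"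
      using x by (simp add: starlike_quotient_g flip: of_real_power)
    then have "\<not> 0 < Re (starlike_quotient g (of_real (sqrt x)))" by (simp only: zero_complex.sel)
    then have "of_real (sqrt x) \<notin> ball (0::complex) r" using r by blast
    then have "r \<le> sqrt x" using x by simp
    also have "\<dots> \<le> sqrt B" using x by simp
    finally show "ereal r \<le> ereal (sqrt B)" by simp
  qed
  also have "\<dots> < ereal (sqrt (power_sum2 b / power_sum3 b))" using B by simp
  finally show ?thesis .
qed

text \<open>The bounds of order 1 are weakenings of those of order 2 and inherit their strictness;
  here S2 \<le> S1^2 is used, below S2^2 \<le> S1 S3.\<close>

lemma starlikeness_radius_lower': "ereal (sqrt (1 / b 1)) < starlikeness_radius g"
proof -
  have "1 / b 1 \<le> sqrt (1 / power_sum2 b)"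
    using power_sum_ineqs(4) power_sums_pos(1) pos[of 1]
    by (intro real_le_rsqrt) (simp add: power_divide frac_le)
  then have "sqrt (1 / b 1) \<le> sqrt (sqrt (1 / power_sum2 b))" by simp
  also have "\<dots> = root 4 (1 / power_sum2 b)"
    using real_root_mult_exp[of 2 2 "1 / power_sum2 b"] by (simp add: sqrt_def)
  finally have "ereal (sqrt (1 / b 1)) \<le> ereal (root 4 (1 / power_sum2 b))" by simp
  also note starlikeness_radius_lower
  finally show ?thesis .
qed

lemma starlikeness_radius_upper': "starlikeness_radius g < ereal (sqrt (b 1 / power_sum2 b))"
proof -
  note starlikeness_radius_upper
  also have "power_sum2 b / power_sum3 b \<le> b 1 / power_sum2 b"
    using power_sum_ineqs(5) power_sums_pos by (simp add: field_simps power2_eq_square)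
  then have "ereal (sqrt (power_sum2 b / power_sum3 b)) \<le> ereal (sqrt (b 1 / power_sum2 b))" by simp
  finally show ?thesis .
qed

end

subsection \<open>Polynomial approximation of the Wright function\<close>

definition iter_euler :: "real \<Rightarrow> real \<Rightarrow> nat \<Rightarrow> real poly \<Rightarrow> real poly" where
  "iter_euler \<rho> \<beta> m p = fold (\<lambda>j. euler_op (\<rho> / (\<beta> + real j))) [0..<m] p"

lemma coeff_iter_euler:
  "coeff (iter_euler \<rho> \<beta> m p) k = (\<Prod>j<m. 1 + \<rho> * real k / (\<beta> + real j)) * coeff p k"
  by (induction m) (simp_all add: iter_euler_def coeff_euler_op)

lemma positive_rooted_iter_euler:
  assumes "0 < \<rho>" "0 < \<beta>" "positive_rooted p"
  shows "positive_rooted (iter_euler \<rho> \<beta> m p)"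
  using assms by (induction m) (auto simp: iter_euler_def intro!: positive_rooted_euler_op)

lemma positive_rooted_linear_power: "0 < c \<Longrightarrow> positive_rooted ([:1, - c:] ^ n)"
  unfolding positive_rooted_def by (intro exI[of _ n] exI[of _ "\<lambda>_. c"]) simp

text \<open>The division by n turns the binomial coefficient into 1 / k! in the limit. The power
  n^(-\<rho>) offsets the growth of the quotient of Pochhammer symbols produced by the operators,
  and n + 1 operators match the length of the product in \<open>Gamma_series\<close>.\<close>

definition wright_poly :: "real \<Rightarrow> real \<Rightarrow> nat \<Rightarrow> real poly" where
  "wright_poly \<rho> \<beta> n = iter_euler \<rho> \<beta> (n + 1) ([:1, - (real n powr - \<rho> / real n):] ^ n)"

lemma positive_rooted_wright_poly:
  assumes "0 < \<rho>" "0 < \<beta>" "0 < n"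
  shows "positive_rooted (wright_poly \<rho> \<beta> n)"
  unfolding wright_poly_def using assms
  by (intro positive_rooted_iter_euler positive_rooted_linear_power) auto

lemma alt_coeff_linear_power: "alt_coeff ([:1, - c:] ^ n) k = real (n choose k) * c ^ k"
proof (cases "k \<le> n")
  case True
  then have "alt_coeff ([:1, - c:] ^ n) k = real (n choose k) * ((-1) ^ k * (- c) ^ k)"
    by (simp add: alt_coeff_def coeff_linear_poly_power)
  also have "(-1) ^ k * (- c) ^ k = c ^ k" by (simp flip: power_mult_distrib)
  finally show ?thesis .
next
  case False
  have "degree ([:1, - c:] ^ n) \<le> n"
    by (rule order_trans[OF degree_power_le]) simp
  with False show ?thesis by (simp add: alt_coeff_def coeff_eq_0 binomial_eq_0)
qed

lemma alt_coeff_wright_poly: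
  assumes "0 < n"
  shows "alt_coeff (wright_poly \<rho> \<beta> n) k =
    (\<Prod>j<n+1. 1 + \<rho> * real k / (\<beta> + real j)) * exp (- (\<rho> * real k * ln (real n)))
      * (real (n choose k) / real n ^ k)"
proof -
  have "alt_coeff (wright_poly \<rho> \<beta> n) k = (\<Prod>j<n+1. 1 + \<rho> * real k / (\<beta> + real j))
      * alt_coeff ([:1, - (real n powr - \<rho> / real n):] ^ n) k"
    by (simp add: alt_coeff_def wright_poly_def coeff_iter_euler)
  moreover have "(real n powr - \<rho> / real n) ^ k = exp (- (\<rho> * real k * ln (real n))) / real n ^ k"
    using assms exp_of_nat_mult[of k "- \<rho> * ln (real n)"]
    by (simp add: powr_def power_divide algebra_simps)
  ultimately show ?thesis by (simp add: alt_coeff_linear_power)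
qed

lemma binomial_over_power_lim: "(\<lambda>n. real (n choose k) / real n ^ k) \<longlonglongrightarrow> 1 / fact k"
proof -
  have "(\<lambda>n. (\<Prod>i<k. 1 - real i / real n) / fact k) \<longlonglongrightarrow> (\<Prod>i<k. 1 - 0) / fact k"
    by (intro tendsto_divide tendsto_prod tendsto_diff tendsto_const lim_const_over_n) simp
  moreover have "eventually (\<lambda>n. (\<Prod>i<k. 1 - real i / real n) / fact k
      = real (n choose k) / real n ^ k) sequentially"
    using eventually_gt_at_top[of 0]
  proof eventually_elim
    case (elim n)
    have "(\<Prod>i<k. 1 - real i / real n) = (\<Prod>i<k. (real n - real i) / real n)"
      using elim by (intro prod.cong) (auto simp: field_simps)
    also have "\<dots> = (\<Prod>i<k. real n - real i) / real n ^ k"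
      by (simp add: prod_dividef)
    finally show ?case
      by (simp add: binomial_gbinomial gbinomial_prod_rev atLeast0LessThan)
  qed
  ultimately have "(\<lambda>n. real (n choose k) / real n ^ k) \<longlonglongrightarrow> (\<Prod>i<k. 1 - 0) / fact k"
    by (rule Lim_transform_eventually)
  then show ?thesis by simp
qed

lemma prod_shift_ratio_lim:
  fixes \<rho> \<beta> :: real
  assumes "0 < \<rho>" "0 < \<beta>"
  shows "(\<lambda>n. (\<Prod>j<n+1. 1 + \<rho> * real k / (\<beta> + real j)) * exp (- (\<rho> * real k * ln (real n))))
    \<longlonglongrightarrow> Gamma \<beta> / Gamma (real k * \<rho> + \<beta>)"
proof -
  let ?z = "real k * \<rho> + \<beta>"
  have z: "0 < ?z" using assms by (simp add: add_nonneg_pos)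
  have "(\<Prod>j<n+1. 1 + \<rho> * real k / (\<beta> + real j)) * exp (- (\<rho> * real k * ln (real n)))
      = Gamma_series \<beta> n / Gamma_series ?z n" for n
  proof -
    have "(\<Prod>j<n+1. 1 + \<rho> * real k / (\<beta> + real j)) = (\<Prod>j<n+1. (?z + real j) / (\<beta> + real j))"
      using assms by (intro prod.cong refl) (simp add: field_simps add_pos_nonneg)
    also have "\<dots> = pochhammer ?z (n + 1) / pochhammer \<beta> (n + 1)"
      by (simp only: prod_dividef pochhammer_prod atLeast0LessThan)
    finally have e: "(\<Prod>j<n+1. 1 + \<rho> * real k / (\<beta> + real j)) =
        pochhammer ?z (n + 1) / pochhammer \<beta> (n + 1)" .
    have ex: "exp (?z * of_real (ln (of_nat n))) =
        exp (\<rho> * real k * ln (real n)) * exp (\<beta> * of_real (ln (of_nat n)))"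
      by (simp add: algebra_simps flip: exp_add)
    have "pochhammer ?z (n + 1) \<noteq> 0" "pochhammer \<beta> (n + 1) \<noteq> 0"
      using pochhammer_pos[OF z, of "n + 1"] pochhammer_pos[OF assms(2), of "n + 1"]
      by (simp_all only: less_imp_neq[THEN not_sym] not_False_eq_True)
    then show ?thesis unfolding e Gamma_series_def ex exp_minus by (simp add: divide_simps)
  qed
  moreover have "(\<lambda>n. Gamma_series \<beta> n / Gamma_series ?z n) \<longlonglongrightarrow> Gamma \<beta> / Gamma ?z"
    using Gamma_real_pos[OF z] by (intro tendsto_divide Gamma_series_LIMSEQ) simp
  ultimately show ?thesis by simp
qed

text \<open>By 1 + x \<le> exp x the product is at most an exponential of a harmonic sum, whose ln n
  is cancelled by the second factor. The bound is free of n and supplies the majorant.\<close>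

lemma prod_shift_ratio_le:
  fixes \<rho> \<beta> :: real
  assumes "0 < \<rho>" "0 < \<beta>" "0 < n"
  shows "(\<Prod>j<n+1. 1 + \<rho> * real k / (\<beta> + real j)) * exp (- (\<rho> * real k * ln (real n)))
    \<le> exp (\<rho> * (1 / \<beta> + 1)) ^ k"
proof -
  have "(\<Sum>j<n+1. 1 / (\<beta> + real j)) = 1 / \<beta> + (\<Sum>j<n. 1 / (\<beta> + real (Suc j)))"
    by (simp add: sum.lessThan_Suc_shift del: sum.lessThan_Suc)
  also have "(\<Sum>j<n. 1 / (\<beta> + real (Suc j))) \<le> (\<Sum>j<n. inverse (real (Suc j)))"
    using assms by (intro sum_mono) (simp add: field_simps)
  \<comment> \<open>The difference of the harmonic number and ln n decreases from its value 1 at n =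
    1.\<close>
  also have "\<dots> \<le> ln (real n) + 1"
    using euler_mascheroni_sequence_decreasing[of 1 n] assms(3)
    by (simp add: harm_altdef)
  finally have S: "(\<Sum>j<n+1. 1 / (\<beta> + real j)) \<le> 1 / \<beta> + 1 + ln (real n)" by simp
  have "(\<Prod>j<n+1. 1 + \<rho> * real k / (\<beta> + real j)) \<le> (\<Prod>j<n+1. exp (\<rho> * real k / (\<beta> + real j)))"
    using assms by (intro prod_mono conjI exp_ge_add_one_self) auto
  also have "\<dots> = exp (\<rho> * real k * (\<Sum>j<n+1. 1 / (\<beta> + real j)))"
    by (subst exp_sum[symmetric]) (simp_all add: sum_distrib_left del: sum.lessThan_Suc)
  also have "\<dots> \<le> exp (\<rho> * real k * (1 / \<beta> + 1 + ln (real n)))"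
    using S assms by (intro exp_le_cancel_iff[THEN iffD2] mult_left_mono) auto
  finally have "(\<Prod>j<n+1. 1 + \<rho> * real k / (\<beta> + real j)) * exp (- (\<rho> * real k * ln (real n)))
      \<le> exp (\<rho> * real k * (1 / \<beta> + 1 + ln (real n))) * exp (- (\<rho> * real k * ln (real n)))"
    by (intro mult_right_mono) auto
  also have "\<dots> = exp (\<rho> * (1 / \<beta> + 1)) ^ k"
    by (simp flip: exp_add exp_of_nat_mult) (simp add: algebra_simps)
  finally show ?thesis .
qed

text \<open>By convexity of ln \<Gamma>, its slope ln (x - 1) between x - 1 and x is at most the
  slope between x and x + \<rho>.\<close>

lemma Gamma_quotient_le:
  fixes x \<rho> :: real
  assumes "1 < x" "0 < \<rho>"
  shows "Gamma x / Gamma (x + \<rho>) \<le> exp (- (\<rho> * ln (x - 1)))"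
proof -
  let ?f = "ln \<circ> Gamma :: real \<Rightarrow> real"
  have pos: "0 < Gamma (x - 1)" "0 < Gamma x" "0 < Gamma (x + \<rho>)"
    using assms by (auto intro!: Gamma_real_pos)
  have fx: "?f x = ln (x - 1) + ?f (x - 1)"
  proof -
    have "x - 1 \<notin> \<int>\<^sub>\<le>\<^sub>0" using assms by (auto elim!: nonpos_Ints_cases)
    then have "Gamma x = (x - 1) * Gamma (x - 1)" using Gamma_plus1[of "x - 1"] by simp
    then show ?thesis using ln_mult_pos[of "x - 1" "Gamma (x - 1)"] pos(1) assms by simp
  qed
  have "(?f (x - 1) - ?f x) / (x - 1 - x) \<le> (?f x - ?f (x + \<rho>)) / (x - (x + \<rho>))"
    using convex_on_slope_le[OF log_convex_Gamma_real, of "x - 1" "x + \<rho>" x] assms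
    by (auto intro: order_trans)
  then have "\<rho> * ln (x - 1) \<le> ?f (x + \<rho>) - ?f x"
    using fx assms by (simp add: field_simps)
  then have "ln (Gamma x / Gamma (x + \<rho>)) \<le> - (\<rho> * ln (x - 1))"
    using pos by (simp add: ln_div)
  then show ?thesis using pos by (metis divide_pos_pos exp_le_cancel_iff exp_ln)
qed

definition wright_coeff :: "real \<Rightarrow> real \<Rightarrow> nat \<Rightarrow> real" where
  "wright_coeff \<rho> \<beta> k = Gamma \<beta> / (fact k * Gamma (real k * \<rho> + \<beta>))"

lemma wright_laguerre_limit:
  assumes "0 < \<rho>" "0 < \<beta>"
  shows "laguerre_limit (\<lambda>N. wright_poly \<rho> \<beta> (Suc N)) (wright_coeff \<rho> \<beta>)
    (\<lambda>k. exp (\<rho> * (1 / \<beta> + 1)) ^ k / fact k)"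
proof
  let ?C = "exp (\<rho> * (1 / \<beta> + 1))"
  show "positive_rooted (wright_poly \<rho> \<beta> (Suc N))" for N
    using assms by (intro positive_rooted_wright_poly) auto
  show "(\<lambda>N. alt_coeff (wright_poly \<rho> \<beta> (Suc N)) k) \<longlonglongrightarrow> wright_coeff \<rho> \<beta> k" for k
  proof (rule LIMSEQ_Suc)
    have "(\<lambda>n. (\<Prod>j<n+1. 1 + \<rho> * real k / (\<beta> + real j)) * exp (- (\<rho> * real k * ln (real n)))
        * (real (n choose k) / real n ^ k)) \<longlonglongrightarrow> Gamma \<beta> / Gamma (real k * \<rho> + \<beta>) * (1 / fact k)"
      by (intro tendsto_mult prod_shift_ratio_lim binomial_over_power_lim assms)
    moreover have "eventually (\<lambda>n. (\<Prod>j<n+1. 1 + \<rho> * real k / (\<beta> + real j))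
        * exp (- (\<rho> * real k * ln (real n))) * (real (n choose k) / real n ^ k)
        = alt_coeff (wright_poly \<rho> \<beta> n) k) sequentially"
      using eventually_gt_at_top[of 0] by eventually_elim (simp only: alt_coeff_wright_poly)
    ultimately show "(\<lambda>n. alt_coeff (wright_poly \<rho> \<beta> n) k) \<longlonglongrightarrow> wright_coeff \<rho> \<beta> k"
      by (auto simp: wright_coeff_def mult.commute elim: Lim_transform_eventually)
  qed
  show "\<bar>alt_coeff (wright_poly \<rho> \<beta> (Suc N)) k\<bar> \<le> ?C ^ k / fact k" for N k
  proof -
    let ?n = "Suc N"
    let ?A = "(\<Prod>j<?n+1. 1 + \<rho> * real k / (\<beta> + real j)) * exp (- (\<rho> * real k * ln (real ?n)))"
    have A: "0 \<le> ?A" "?A \<le> ?C ^ k"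
    proof -
      show "0 \<le> ?A"
        using assms by (intro mult_nonneg_nonneg prod_nonneg ballI add_nonneg_nonneg divide_nonneg_nonneg) auto
      show "?A \<le> ?C ^ k" using assms by (intro prod_shift_ratio_le) auto
    qed
    have "real ((?n choose k) * fact k) \<le> real (?n ^ k)"
      using binomial_fact_pow of_nat_le_iff by blast
    then have "real (?n choose k) / real ?n ^ k \<le> 1 / fact k"
      by (simp add: field_simps del: of_nat_Suc)
    then have "?A * (real (?n choose k) / real ?n ^ k) \<le> ?C ^ k * (1 / fact k)"
      using A by (intro mult_mono) auto
    moreover have "0 \<le> ?A * (real (?n choose k) / real ?n ^ k)" by (intro mult_nonneg_nonneg[OF A(1)]) simp
    ultimately show ?thesis
      unfolding alt_coeff_wright_poly[OF zero_less_Suc] by (simp only: abs_of_nonneg mult_1_right times_divide_eq_right)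
  qed
  show "summable (\<lambda>k. ?C ^ k / fact k * r ^ k)" for r
    using summable_exp[of "?C * r"] by (simp add: field_simps power_mult_distrib)
  have G: "0 < Gamma (real k * \<rho> + \<beta>)" for k
    using assms by (intro Gamma_real_pos) (simp add: add_nonneg_pos)
  show "0 < wright_coeff \<rho> \<beta> k" for k
    using G[of k] G[of 0] by (simp add: wright_coeff_def)
  show "(\<lambda>k. real (k + 1) * wright_coeff \<rho> \<beta> (k + 1) / wright_coeff \<rho> \<beta> k) \<longlonglongrightarrow> 0"
  proof (rule tendsto_sandwich[where f = "\<lambda>_. 0"
        and h = "\<lambda>k. exp (- (\<rho> * ln (real k * \<rho> + \<beta> - 1)))"])
    have x: "filterlim (\<lambda>k. real k * \<rho> + \<beta> - 1) at_top sequentially"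
    proof -
      have "filterlim (\<lambda>k. (\<beta> - 1) + \<rho> * real k) at_top sequentially"
        using assms(1) by (intro filterlim_tendsto_add_at_top[OF tendsto_const]
          filterlim_tendsto_pos_mult_at_top[OF tendsto_const] filterlim_real_sequentially)
      then show ?thesis by (simp add: algebra_simps)
    qed
    have "filterlim (\<lambda>k. \<rho> * ln (real k * \<rho> + \<beta> - 1)) at_top sequentially"
      using assms(1) by (intro filterlim_tendsto_pos_mult_at_top[OF tendsto_const]
        filterlim_compose[OF ln_at_top x])
    then show "(\<lambda>k. exp (- (\<rho> * ln (real k * \<rho> + \<beta> - 1)))) \<longlonglongrightarrow> 0"
      by (intro filterlim_compose[OF exp_at_bot] filterlim_uminus_at_bot[THEN iffD2]) simp
    have eq: "real (k + 1) * wright_coeff \<rho> \<beta> (k + 1) / wright_coeff \<rho> \<beta> k =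
        Gamma (real k * \<rho> + \<beta>) / Gamma (real k * \<rho> + \<beta> + \<rho>)" for k
    proof -
      have gen: "u * (c / (u * f * B)) / (c / (f * A)) = A / B"
        if "u \<noteq> 0" "c \<noteq> 0" "f \<noteq> 0" "A \<noteq> 0" for u c f A B :: real
        using that by simp
      have s: "real (k + 1) * \<rho> + \<beta> = real k * \<rho> + \<beta> + \<rho>" "fact (k + 1) = real (k + 1) * fact k"
        by (simp_all add: algebra_simps)
      show ?thesis
        unfolding wright_coeff_def s using G[of k] G[of 0] by (intro gen) auto
    qed
    \<comment> \<open>\<open>Gamma_quotient_le\<close> needs an argument above 1, which holds for
      large k.\<close>
    show "eventually (\<lambda>k. real (k + 1) * wright_coeff \<rho> \<beta> (k + 1) / wright_coeff \<rho> \<beta> k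
        \<le> exp (- (\<rho> * ln (real k * \<rho> + \<beta> - 1)))) sequentially"
      using filterlim_at_top_dense[THEN iffD1, OF x, rule_format, of 0] unfolding eq
      by eventually_elim (use assms in \<open>auto intro!: Gamma_quotient_le\<close>)
    have "0 \<le> real (k + 1) * wright_coeff \<rho> \<beta> (k + 1) / wright_coeff \<rho> \<beta> k" for k
      using G[of k] G[of "k + 1"] G[of 0] by (simp add: wright_coeff_def)
    then show "eventually (\<lambda>k. 0 \<le> real (k + 1) * wright_coeff \<rho> \<beta> (k + 1) / wright_coeff \<rho> \<beta> k) sequentially"
      by (intro always_eventually allI)
  qed (rule tendsto_const)
qed

section \<open>The four bounds in terms of Gamma values\<close>

theorem theorem3:
  fixes \<rho> \<beta> :: real
  assumes "\<rho> > 0" and "\<beta> > 0"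
  shows
    "ereal (sqrt (Gamma (\<rho> + \<beta>) / (3 * Gamma \<beta>)))
       < starlikeness_radius (wright_g \<rho> \<beta>)
     \<and> starlikeness_radius (wright_g \<rho> \<beta>)
       < ereal (sqrt (3 * Gamma (\<rho> + \<beta>) * Gamma (2 * \<rho> + \<beta>) / wright_Delta 9 5 \<rho> \<beta>))
     \<and> ereal (root 4 ((Gamma (\<rho> + \<beta>))\<^sup>2 * Gamma (2 * \<rho> + \<beta>)
                / (Gamma \<beta> * wright_Delta 9 5 \<rho> \<beta>)))
       < starlikeness_radius (wright_g \<rho> \<beta>)
     \<and> starlikeness_radius (wright_g \<rho> \<beta>)
       < ereal (sqrt (2 * Gamma (\<rho> + \<beta>) * Gamma (3 * \<rho> + \<beta>) * wright_Delta 9 5 \<rho> \<beta>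
                / (9 * Gamma \<beta> * Gamma (3 * \<rho> + \<beta>) * wright_Delta 6 5 \<rho> \<beta>
                   + 7 * Gamma (\<rho> + \<beta>) ^ 3 * Gamma (2 * \<rho> + \<beta>))))"
proof -
  interpret W: laguerre_limit "\<lambda>N. wright_poly \<rho> \<beta> (Suc N)" "wright_coeff \<rho> \<beta>"
    "\<lambda>k. exp (\<rho> * (1 / \<beta> + 1)) ^ k / fact k"
    by (rule wright_laguerre_limit[OF assms])
  define G0 where "G0 = Gamma \<beta>"
  define G1 where "G1 = Gamma (\<rho> + \<beta>)"
  define G2 where "G2 = Gamma (2 * \<rho> + \<beta>)"
  define G3 where "G3 = Gamma (3 * \<rho> + \<beta>)"
  have pos: "0 < G0" "0 < G1" "0 < G2" "0 < G3"
    using assms by (auto simp: G0_def G1_def G2_def G3_def intro!: Gamma_real_pos add_pos_pos)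
  have g: "wright_g \<rho> \<beta> = W.g"
  proof
    fix z :: complex
    have "(- (z\<^sup>2)) ^ n / (fact n * of_real (Gamma (real n * \<rho> + \<beta>))) =
        of_real (W.ca n) * (z\<^sup>2) ^ n / of_real G0" for n
      using pos(1) by (simp add: W.ca_def wright_coeff_def G0_def power_minus[of "z\<^sup>2"] field_simps)
    then have "wright \<rho> \<beta> (- (z\<^sup>2)) = W.f (z\<^sup>2) / of_real G0"
      unfolding wright_def W.f_def by (simp add: suminf_divide[OF W.F.summable_series])
    then show "wright_g \<rho> \<beta> z = W.g z"
      using pos(1) by (simp add: wright_g_def G0_def)
  qed
  have b: "W.b 1 = 3 * G0 / G1" "W.b 2 = 5 * G0 / (2 * G2)" "W.b 3 = 7 * G0 / (6 * G3)"
    by (simp_all add: W.b_def wright_coeff_def G0_def G1_def G2_def G3_def fact_numeral)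
  have S2: "power_sum2 W.b = G0 * (9 * G0 * G2 - 5 * G1\<^sup>2) / (G1\<^sup>2 * G2)"
    using pos unfolding power_sum2_def b
    by (simp add: divide_simps) (simp add: power2_eq_square algebra_simps)
  have S3: "power_sum3 W.b =
      G0 * (9 * G0 * G3 * (6 * G0 * G2 - 5 * G1\<^sup>2) + 7 * G1 ^ 3 * G2) / (2 * G1 ^ 3 * G2 * G3)"
    using pos unfolding power_sum3_def b
    by (simp add: divide_simps) (simp add: power2_eq_square power3_eq_cube algebra_simps)
  define D where "D = 9 * G0 * G2 - 5 * G1\<^sup>2"
  define E where "E = 9 * G0 * G3 * (6 * G0 * G2 - 5 * G1\<^sup>2) + 7 * G1 ^ 3 * G2"
  have q: "0 < G1\<^sup>2 * G2" "0 < 2 * G1 ^ 3 * G2 * G3" using pos by simp_all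
  \<comment> \<open>\<open>D\<close> and \<open>E\<close> are the denominators in the claimed bounds
    and numerators of the power sums, so positivity of the latter excludes division by 0.\<close>
  have DE: "0 < D" "0 < E"
    using W.power_sums_pos(1,2) pos(1) unfolding S2 S3 D_def[symmetric] E_def[symmetric]
    by (simp_all only: pos_less_divide_eq[OF q(1)] pos_less_divide_eq[OF q(2)] mult_zero_left
        zero_less_mult_pos)
  have "1 / W.b 1 = G1 / (3 * G0)" unfolding b by simp
  from W.starlikeness_radius_lower'[unfolded this]
  have 1: "ereal (sqrt (G1 / (3 * G0))) < starlikeness_radius W.g" .
  have "W.b 1 / power_sum2 W.b = 3 * G1 * G2 / D"
    unfolding b S2 D_def[symmetric] using pos DE by (simp add: divide_simps power2_eq_square)
  from W.starlikeness_radius_upper'[unfolded this]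
  have 2: "starlikeness_radius W.g < ereal (sqrt (3 * G1 * G2 / D))" .
  have "1 / power_sum2 W.b = G1\<^sup>2 * G2 / (G0 * D)"
    unfolding S2 D_def[symmetric] by simp
  from W.starlikeness_radius_lower[unfolded this]
  have 3: "ereal (root 4 (G1\<^sup>2 * G2 / (G0 * D))) < starlikeness_radius W.g" .
  have "power_sum2 W.b / power_sum3 W.b = 2 * G1 * G3 * D / E"
    unfolding S2 S3 D_def[symmetric] E_def[symmetric] using pos DE
    by (simp add: divide_simps power2_eq_square power3_eq_cube)
  from W.starlikeness_radius_upper[unfolded this]
  have 4: "starlikeness_radius W.g < ereal (sqrt (2 * G1 * G3 * D / E))" .
  show ?thesis
    unfolding wright_Delta_def G0_def[symmetric] G1_def[symmetric] G2_def[symmetric]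
      G3_def[symmetric] D_def[symmetric] E_def[symmetric] g
    using 1 2 3 4 by (intro conjI)
qed

end
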